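(* Let $k\in\mathbb N_0$, $0<\alpha\le1$ and $f\in\mathcal C^{k,\alpha}(\mathbb S^2)$. Then for all $n\in\mathbb Z^2\setminus\{0\}$ the Fourier coefficients of the DFS function $\tilde f$ satisfy $$|c_n(\tilde f)|\le 2^{\frac{k+\alpha}{2}-1}\pi^\alpha\,\frac{(k+3)!}{|n|^{k+\alpha}}\,\|f\|_{\mathcal C^{k,\alpha}(\mathbb S^2)}.$$
   Context: $|n|$ denotes the Euclidean norm of $n\in\mathbb Z^2$; $\|\cdot\|$ Euclidean norm; $B^d_k:=\{\beta\in\mathbb N_0^d:\sum_i\beta_i\le k\}$. For open $U\subset\mathbb R^d$: $\mathcal C^k(U)$ the bounded uniformly continuous complex functions whose classical derivatives $D^\beta f$, $\beta\in B^d_k$, are bounded and uniformly continuous; for $0<\alpha<1$, $\mathcal C^{k,\alpha}(U)$ those with $\sup\{|D^\beta f(x)-D^\beta f(y)|/\|x-y\|^\alpha:x\ne y,|\beta|=k\}<\infty$. Sphere: for $0\le\alpha<1$, $\|f\|_{\mathcal C^{k,\alpha}(\mathbb S^2)}$ is the infimum, over all $f^*\in\mathcal C^{k,\alpha}(U)$ with $U\supset\mathbb S^2$ open and $f^*|_{\mathbb S^2}=f$ ($\mathcal C^{k,0}=\mathcal C^k$), of $\sum_{\beta\in B^3_k}\sup_{\mathbb S^2}|D^\beta f^*|$ plus (if $\alpha>0$) $\sup\{|D^\beta f^*(\xi)-D^\beta f^*(\eta)|/\|\xi-\eta\|^\alpha:\xi\ne\eta\in\mathbb S^2,|\beta|=k\}$;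 $\mathcal C^{k,\alpha}(\mathbb S^2)$ consists of $f$ with finite norm. Convention: $\mathcal C^{k,1}(\mathbb S^2):=\mathcal C^{k+1}(\mathbb S^2)$ with $\|\cdot\|_{\mathcal C^{k,1}(\mathbb S^2)}:=\|\cdot\|_{\mathcal C^{k+1}(\mathbb S^2)}$. DFS function: $\tilde f=f\circ\phi$, $\phi(\lambda,\theta)=(\cos\lambda\sin\theta,\sin\lambda\sin\theta,\cos\theta)$, on $\mathbb T^2=\mathbb R^2/(2\pi\mathbb Z^2)$; $c_n(g)=(2\pi)^{-2}\int_{\mathbb T^2}g(x)e^{-i\langle n,x\rangle}dx$. *)

theory Defs
  imports "HOL-Analysis.Analysis"
begin

definition dir :: "nat \<Rightarrow> real^3" where
  "dir i = (if i = 1 then vector [1,0,0] else if i = 2 then vector [0,1,0] else vector [0,0,1])"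

definition pd :: "nat \<Rightarrow> (real^3 \<Rightarrow> complex) \<Rightarrow> real^3 \<Rightarrow> complex" where
  "pd i g x = vector_derivative (\<lambda>t::real. g (x + t *\<^sub>R dir i)) (at 0)"

definition pd_exists :: "nat \<Rightarrow> (real^3 \<Rightarrow> complex) \<Rightarrow> real^3 \<Rightarrow> bool" where
  "pd_exists i g x \<longleftrightarrow> (\<lambda>t::real. g (x + t *\<^sub>R dir i)) differentiable (at 0)"

fun iterd :: "nat list \<Rightarrow> (real^3 \<Rightarrow> complex) \<Rightarrow> real^3 \<Rightarrow> complex" where
  "iterd [] g = g"
| "iterd (i # is) g = pd i (iterd is g)"

definition canon :: "nat \<times> nat \<times> nat \<Rightarrow> nat list" where
  "canon \<beta> = (case \<beta> of (a, b, c) \<Rightarrow> replicate a 1 @ replicate b 2 @ replicate c 3)"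

definition Dm :: "nat \<times> nat \<times> nat \<Rightarrow> (real^3 \<Rightarrow> complex) \<Rightarrow> real^3 \<Rightarrow> complex" where
  "Dm \<beta> g = iterd (canon \<beta>) g"

definition mord :: "nat \<times> nat \<times> nat \<Rightarrow> nat" where
  "mord \<beta> = (case \<beta> of (a, b, c) \<Rightarrow> a + b + c)"

definition Bk :: "nat \<Rightarrow> (nat \<times> nat \<times> nat) set" where
  "Bk k = {\<beta>. mord \<beta> \<le> k}"

definition Ck :: "(real^3) set \<Rightarrow> nat \<Rightarrow> (real^3 \<Rightarrow> complex) \<Rightarrow> bool" where
  "Ck U k g \<longleftrightarrow>
     (\<forall>\<beta>\<in>Bk k. \<forall>i ds. canon \<beta> = i # ds \<longrightarrow> (\<forall>x\<in>U. pd_exists i (iterd ds g) x)) \<and>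
     (\<forall>\<beta>\<in>Bk k. bounded (Dm \<beta> g ` U) \<and> uniformly_continuous_on U (Dm \<beta> g))"

definition holder_quots :: "(real^3) set \<Rightarrow> nat \<Rightarrow> real \<Rightarrow> (real^3 \<Rightarrow> complex) \<Rightarrow> real set" where
  "holder_quots S k \<alpha> g =
     {cmod (Dm \<beta> g x - Dm \<beta> g y) / norm (x - y) powr \<alpha> | x y \<beta>.
        x \<in> S \<and> y \<in> S \<and> x \<noteq> y \<and> mord \<beta> = k}"

definition Cka :: "(real^3) set \<Rightarrow> nat \<Rightarrow> real \<Rightarrow> (real^3 \<Rightarrow> complex) \<Rightarrow> bool" where
  "Cka U k \<alpha> g \<longleftrightarrow> Ck U k g \<and> (\<alpha> > 0 \<longrightarrow> bdd_above (holder_quots U k \<alpha> g))"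

abbreviation S2 :: "(real^3) set" where "S2 \<equiv> sphere 0 1"

definition ext_norm :: "nat \<Rightarrow> real \<Rightarrow> (real^3 \<Rightarrow> complex) \<Rightarrow> real" where
  "ext_norm k \<alpha> g =
     (\<Sum>\<beta>\<in>Bk k. Sup ((\<lambda>x. cmod (Dm \<beta> g x)) ` S2)) +
     (if \<alpha> > 0 then Sup (holder_quots S2 k \<alpha> g) else 0)"

definition extensions :: "nat \<Rightarrow> real \<Rightarrow> (real^3 \<Rightarrow> complex) \<Rightarrow> (real^3 \<Rightarrow> complex) set" where
  "extensions k \<alpha> f = {g. \<exists>U. open U \<and> S2 \<subseteq> U \<and> Cka U k \<alpha> g \<and> (\<forall>x\<in>S2. g x = f x)}"

text \<open>Norm for 0 <= alpha < 1 (alpha = 0 meaning C^k).\<close>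
definition sph_norm0 :: "nat \<Rightarrow> real \<Rightarrow> (real^3 \<Rightarrow> complex) \<Rightarrow> real" where
  "sph_norm0 k \<alpha> f = Inf (ext_norm k \<alpha> ` extensions k \<alpha> f)"

definition sph_space0 :: "nat \<Rightarrow> real \<Rightarrow> (real^3 \<Rightarrow> complex) \<Rightarrow> bool" where
  "sph_space0 k \<alpha> f \<longleftrightarrow> extensions k \<alpha> f \<noteq> {}"

text \<open>With the convention C^{k,1}(S^2) := C^{k+1}(S^2).\<close>
definition C_sphere :: "nat \<Rightarrow> real \<Rightarrow> (real^3 \<Rightarrow> complex) \<Rightarrow> bool" where
  "C_sphere k \<alpha> f \<longleftrightarrow> (if \<alpha> = 1 then sph_space0 (k + 1) 0 f else sph_space0 k \<alpha> f)"

definition C_sphere_norm :: "nat \<Rightarrow> real \<Rightarrow> (real^3 \<Rightarrow> complex) \<Rightarrow> real" where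
  "C_sphere_norm k \<alpha> f = (if \<alpha> = 1 then sph_norm0 (k + 1) 0 f else sph_norm0 k \<alpha> f)"

definition sph_param :: "real \<Rightarrow> real \<Rightarrow> real^3" where
  "sph_param lam th = vector [cos lam * sin th, sin lam * sin th, cos th]"

definition dfs :: "(real^3 \<Rightarrow> complex) \<Rightarrow> real \<times> real \<Rightarrow> complex" where
  "dfs f = (\<lambda>(lam, th). f (sph_param lam th))"

definition fourier_coeff :: "(real \<times> real \<Rightarrow> complex) \<Rightarrow> int \<times> int \<Rightarrow> complex" where
  "fourier_coeff g n =
     complex_of_real (1 / (2 * pi)^2) *
     integral (cbox (0, 0) (2 * pi, 2 * pi))
       (\<lambda>(x, y). g (x, y) * cis (- (of_int (fst n) * x + of_int (snd n) * y)))"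

definition int_norm :: "int \<times> int \<Rightarrow> real" where
  "int_norm n = sqrt (of_int (fst n)^2 + of_int (snd n)^2)"

end

theory Submission
  imports Defs
begin

text \<open>Let \<open>p\<close> be the component of \<open>n\<close> that is larger in absolute value, so that
  \<open>\<bar>n\<bar> \<le> sqrt 2 \<bar>p\<bar>\<close>. In the corresponding variable the DFS function is an extension \<open>g\<close> of \<open>f\<close> along a
  circle \<open>\<gamma>\<close> on the sphere (a latitude or a meridian), and it suffices to bound the Fourier coefficients
  of \<open>g \<circ> \<gamma>\<close>. The \<open>m\<close>-th derivative of \<open>g \<circ> \<gamma>\<close> is a sum of terms \<open>Q\<^sub>\<beta> D\<^sup>\<beta> g(\<gamma>)\<close>, where \<open>Q\<^sub>\<beta>\<close> is a sum of at
  most \<open>(m + 2)! / 2\<close> products of \<open>\<bar>\<beta>\<bar>\<close> bounded sinusoids: differentiating once more produces at most \<open>m\<close> times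
  as many products from \<open>Q\<^sub>\<beta>\<close> itself and three contributions from the indices \<open>\<beta> - e\<^sub>i\<close>. Integrating by
  parts \<open>k\<close> times gains \<open>\<bar>p\<bar> ^ k\<close>, and comparing the \<open>k\<close>-th derivative with its shift by half a period
  \<open>\<pi> / \<bar>p\<bar>\<close> gains the factor \<open>(\<pi> / \<bar>p\<bar>) powr \<alpha> / 2\<close>.\<close>

section \<open>Directional derivatives\<close>

lemma norm_diff_le_vector_derivative:
  fixes f :: "real \<Rightarrow> 'b::real_normed_vector"
  assumes "\<And>s. s \<in> closed_segment a b \<Longrightarrow> (f has_vector_derivative f' s) (at s)"
    and "\<And>s. s \<in> closed_segment a b \<Longrightarrow> norm (f' s) \<le> B"
  shows "norm (f b - f a) \<le> B * \<bar>b - a\<bar>"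
proof -
  have "norm (f b - f a) \<le> B * norm (b - a)"
  proof (rule differentiable_bound[of "closed_segment a b" f "\<lambda>s h. h *\<^sub>R f' s" B b a])
    fix s assume s: "s \<in> closed_segment a b"
    show "(f has_derivative (\<lambda>h. h *\<^sub>R f' s)) (at s within closed_segment a b)"
      using assms(1)[OF s] unfolding has_vector_derivative_def by (rule has_derivative_at_withinI)
    show "onorm (\<lambda>h. h *\<^sub>R f' s) \<le> B"
      by (rule onorm_le) (use assms(2)[OF s] in \<open>simp add: mult.commute[of B] mult_left_mono\<close>)
  qed auto
  then show ?thesis by simp
qed

abbreviation has_dir_deriv ::
  "('a::real_normed_vector \<Rightarrow> 'b::real_normed_vector) \<Rightarrow> 'a \<Rightarrow> 'a \<Rightarrow> 'b \<Rightarrow> bool" where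
  "has_dir_deriv u d x a \<equiv> ((\<lambda>t. u (x + t *\<^sub>R d)) has_vector_derivative a) (at 0)"

lemma has_dir_deriv_line:
  assumes "has_dir_deriv u d (x + s *\<^sub>R d) a"
  shows "((\<lambda>t. u (x + t *\<^sub>R d)) has_vector_derivative a) (at s)"
proof -
  have "((\<lambda>t. t - s) has_vector_derivative 1) (at s)"
    by (auto intro!: derivative_eq_intros)
  moreover have "((\<lambda>t. u (x + s *\<^sub>R d + t *\<^sub>R d)) has_vector_derivative a) (at (s - s))"
    using assms by simp
  ultimately have "((\<lambda>t. u (x + s *\<^sub>R d + t *\<^sub>R d)) \<circ> (\<lambda>t. t - s) has_vector_derivative 1 *\<^sub>R a) (at s)"
    by (rule vector_diff_chain_at)
  then show ?thesis
    by (simp add: o_def algebra_simps)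
qed

text \<open>Mean value inequality for
  \<open>s \<mapsto> u (y + s *\<^sub>R d) - s *\<^sub>R c\<close>; convexity of the ball keeps the
  segment inside. The estimate is uniform in the base point \<open>y\<close>, as both Schwarz's
  theorem and total differentiability require.\<close>

lemma dir_deriv_linear_approx:
  assumes "\<And>y. y \<in> ball x r \<Longrightarrow> has_dir_deriv u d y (A y)"
    and "\<And>y. y \<in> ball x r \<Longrightarrow> norm (A y - c) \<le> \<epsilon>"
    and "y \<in> ball x r" "y + t *\<^sub>R d \<in> ball x r"
  shows "norm (u (y + t *\<^sub>R d) - u y - t *\<^sub>R c) \<le> \<epsilon> * \<bar>t\<bar>"
proof -
  have mem: "y + s *\<^sub>R d \<in> ball x r" if s: "s \<in> closed_segment 0 t" for s
  proof -
    obtain v where v: "0 \<le> v" "v \<le> 1" "s = v * t"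
      using s by (auto simp: in_segment)
    have "y + s *\<^sub>R d = (1 - v) *\<^sub>R y + v *\<^sub>R (y + t *\<^sub>R d)"
      by (simp add: v(3) algebra_simps)
    then show ?thesis
      using convexD_alt[OF convex_ball assms(3,4) v(1,2)] by simp
  qed
  have "norm ((\<lambda>s. u (y + s *\<^sub>R d) - s *\<^sub>R c) t - (\<lambda>s. u (y + s *\<^sub>R d) - s *\<^sub>R c) 0) \<le> \<epsilon> * \<bar>t - 0\<bar>"
  proof (rule norm_diff_le_vector_derivative[where f' = "\<lambda>s. A (y + s *\<^sub>R d) - c"])
    fix s assume "s \<in> closed_segment 0 t"
    note m = mem[OF this]
    show "((\<lambda>s. u (y + s *\<^sub>R d) - s *\<^sub>R c) has_vector_derivative A (y + s *\<^sub>R d) - c) (at s)"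
      using has_dir_deriv_line[OF assms(1)[OF m]] by (auto intro!: derivative_eq_intros)
    show "norm (A (y + s *\<^sub>R d) - c) \<le> \<epsilon>"
      by (rule assms(2)[OF m])
  qed
  then show ?thesis by (simp add: algebra_simps)
qed

text \<open>Peano's form of Schwarz's theorem: the second mixed derivative need not be assumed to exist.\<close>

lemma mixed_partial_swap:
  fixes u :: "'a::real_normed_vector \<Rightarrow> 'b::real_normed_vector"
  assumes "open U" "x \<in> U"
    and A: "\<And>y. y \<in> U \<Longrightarrow> has_dir_deriv u d y (A y)"
    and B: "\<And>y. y \<in> U \<Longrightarrow> has_dir_deriv u e y (B y)"
    and C: "\<And>y. y \<in> U \<Longrightarrow> has_dir_deriv B d y (C y)"
    and cont: "continuous_on U C"
  shows "has_dir_deriv A e x (C x)"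
  unfolding has_vector_derivative_def has_derivative_at_alt
proof (intro conjI allI impI)
  show "bounded_linear (\<lambda>h. h *\<^sub>R C x)" by (rule bounded_linear_scaleR_left)
  fix \<epsilon> :: real assume \<epsilon>: "\<epsilon> > 0"
  have "isCont C x"
    using cont assms(1,2) by (simp add: continuous_on_eq_continuous_at)
  then obtain r1 where r1: "r1 > 0" "\<And>y. dist y x < r1 \<Longrightarrow> dist (C y) (C x) < \<epsilon>"
    using \<epsilon> unfolding continuous_at_eps_delta by blast
  obtain r2 where r2: "r2 > 0" "ball x r2 \<subseteq> U"
    using assms(1,2) open_contains_ball by blast
  define r where "r = min r1 r2"
  have r: "r > 0" "\<And>y. y \<in> ball x r \<Longrightarrow> y \<in> U" "\<And>y. y \<in> ball x r \<Longrightarrow> norm (C y - C x) \<le> \<epsilon>"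
    using r1 r2 by (auto simp: r_def dist_norm subset_iff norm_minus_commute less_imp_le)
  \<comment> \<open>Any value above \<open>norm d + norm e\<close> keeps the parallelogram with
    sides below \<open>r / N\<close> inside the ball; the summand 1 also makes \<open>N\<close>
    positive when both directions vanish.\<close>
  define N where "N = norm d + norm e + 1"
  have N: "N > 0" unfolding N_def by (simp add: add_nonneg_pos)
  have mem: "x + s *\<^sub>R e + t *\<^sub>R d \<in> ball x r" if "\<bar>s\<bar> < r / N" "\<bar>t\<bar> < r / N" for s t
  proof -
    have "norm (s *\<^sub>R e + t *\<^sub>R d) \<le> \<bar>s\<bar> * norm e + \<bar>t\<bar> * norm d"
      by (metis norm_triangle_ineq norm_scaleR)
    also have "\<dots> \<le> (r / N) * norm e + (r / N) * norm d"
      using that by (intro add_mono mult_right_mono) auto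
    also have "\<dots> = r / N * (N - 1)" by (simp add: N_def algebra_simps add_divide_distrib)
    also have "\<dots> < r / N * N"
      using r(1) N by (intro mult_strict_left_mono) auto
    finally have "norm (s *\<^sub>R e + t *\<^sub>R d) < r" using N by simp
    moreover have "dist x (x + s *\<^sub>R e + t *\<^sub>R d) = norm (s *\<^sub>R e + t *\<^sub>R d)"
      by (metis add.assoc add_diff_cancel_left' dist_norm norm_minus_commute)
    ultimately show ?thesis by simp
  qed
  have mem0: "x + s *\<^sub>R e \<in> ball x r" if "\<bar>s\<bar> < r / N" for s
    using mem[of s 0] that r N by simp
  show "\<exists>\<delta>>0. \<forall>t. norm (t - 0) < \<delta> \<longrightarrow>
      norm (A (x + t *\<^sub>R e) - A (x + 0 *\<^sub>R e) - (t - 0) *\<^sub>R C x) \<le> \<epsilon> * norm (t - 0)"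
  proof (intro exI[of _ "r / N"] conjI allI impI)
    show "r / N > 0" using r(1) N by simp
    fix t :: real assume t: "norm (t - 0) < r / N"
    have seg: "\<bar>\<tau>\<bar> < r / N" if "\<tau> \<in> closed_segment 0 t" for \<tau>
      using that t by (auto simp: closed_segment_eq_real_ivl split: if_splits)
    \<comment> \<open>\<open>\<phi> s t - \<phi> s 0\<close> is the mixed second difference of
      \<open>u\<close> minus its expected value \<open>(t * s) *\<^sub>R C x\<close>.
      Differentiating along \<open>e\<close> leaves an increment of \<open>B\<close> along
      \<open>d\<close>, which is controlled by \<open>C\<close>.\<close>
    define \<phi> where "\<phi> s \<tau> = u (x + \<tau> *\<^sub>R e + s *\<^sub>R d) - u (x + \<tau> *\<^sub>R e) - (\<tau> * s) *\<^sub>R C x" for s \<tau>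
    have bound: "norm (\<phi> s t - \<phi> s 0) \<le> (\<epsilon> * \<bar>s\<bar>) * \<bar>t - 0\<bar>" if s: "\<bar>s\<bar> < r / N" for s
    proof (rule norm_diff_le_vector_derivative
        [where f' = "\<lambda>\<tau>. B (x + \<tau> *\<^sub>R e + s *\<^sub>R d) - B (x + \<tau> *\<^sub>R e) - s *\<^sub>R C x"])
      fix \<tau> assume \<tau>: "\<tau> \<in> closed_segment 0 t"
      have m: "x + \<tau> *\<^sub>R e + s *\<^sub>R d \<in> ball x r" "x + \<tau> *\<^sub>R e \<in> ball x r"
        using mem[OF seg[OF \<tau>] s] mem0[OF seg[OF \<tau>]] by auto
      have "((\<lambda>\<tau>. u ((x + s *\<^sub>R d) + \<tau> *\<^sub>R e)) has_vector_derivative B ((x + s *\<^sub>R d) + \<tau> *\<^sub>R e)) (at \<tau>)"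
        by (rule has_dir_deriv_line, rule B, rule r(2)) (use m(1) in \<open>simp add: add_ac\<close>)
      moreover have "((\<lambda>\<tau>. u (x + \<tau> *\<^sub>R e)) has_vector_derivative B (x + \<tau> *\<^sub>R e)) (at \<tau>)"
        using has_dir_deriv_line[of u x \<tau> e] B r(2) m(2) by simp
      ultimately show "(\<phi> s has_vector_derivative
          B (x + \<tau> *\<^sub>R e + s *\<^sub>R d) - B (x + \<tau> *\<^sub>R e) - s *\<^sub>R C x) (at \<tau>)"
        unfolding \<phi>_def by (auto intro!: derivative_eq_intros simp: add_ac)
      show "norm (B (x + \<tau> *\<^sub>R e + s *\<^sub>R d) - B (x + \<tau> *\<^sub>R e) - s *\<^sub>R C x) \<le> \<epsilon> * \<bar>s\<bar>"
        by (rule dir_deriv_linear_approx[where A = C]) (use C r m in auto)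
    qed
    have lim: "((\<lambda>s. (u (y + s *\<^sub>R d) - u y) /\<^sub>R s) \<longlongrightarrow> A y) (at 0)" if "y \<in> U" for y
    proof -
      have "((\<lambda>h. norm (u (y + h *\<^sub>R d) - u y - h *\<^sub>R A y) / norm h) \<longlongrightarrow> 0) (at 0)"
        using A[OF that] by (simp add: has_vector_derivative_def has_derivative_at)
      moreover have "\<forall>\<^sub>F h in at 0. norm (u (y + h *\<^sub>R d) - u y - h *\<^sub>R A y) / norm h
          = norm ((u (y + h *\<^sub>R d) - u y) /\<^sub>R h - A y)"
        unfolding eventually_at
      proof (intro exI[of _ 1] conjI ballI impI)
        fix h :: real assume "h \<noteq> 0 \<and> dist h 0 < 1"
        then have "(u (y + h *\<^sub>R d) - u y) /\<^sub>R h - A y = (u (y + h *\<^sub>R d) - u y - h *\<^sub>R A y) /\<^sub>R h"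
          by (simp add: scaleR_diff_right)
        then show "norm (u (y + h *\<^sub>R d) - u y - h *\<^sub>R A y) / norm h
          = norm ((u (y + h *\<^sub>R d) - u y) /\<^sub>R h - A y)"
          by (simp add: divide_inverse mult.commute)
      qed simp
      ultimately have "((\<lambda>h. norm ((u (y + h *\<^sub>R d) - u y) /\<^sub>R h - A y)) \<longlongrightarrow> 0) (at 0)"
        by (rule Lim_transform_eventually)
      then show ?thesis
        by (simp add: tendsto_norm_zero_iff LIM_zero_iff)
    qed
    have tx: "x + t *\<^sub>R e \<in> U" using mem0[of t] t r(2) by simp
    \<comment> \<open>Dividing the second difference by \<open>s\<close> and letting
      \<open>s\<close> tend to 0 turns the increments along \<open>d\<close> into values of
      \<open>A\<close>, while the bound \<open>\<epsilon> * \<bar>t\<bar>\<close> does not depend on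
      \<open>s\<close>.\<close>
    have "((\<lambda>s. norm ((u (x + t *\<^sub>R e + s *\<^sub>R d) - u (x + t *\<^sub>R e)) /\<^sub>R s
            - (u (x + s *\<^sub>R d) - u x) /\<^sub>R s - t *\<^sub>R C x))
        \<longlongrightarrow> norm (A (x + t *\<^sub>R e) - A x - t *\<^sub>R C x)) (at 0)"
      by (intro tendsto_intros lim tx assms(2))
    moreover have "\<forall>\<^sub>F s in at 0. norm ((u (x + t *\<^sub>R e + s *\<^sub>R d) - u (x + t *\<^sub>R e)) /\<^sub>R s
            - (u (x + s *\<^sub>R d) - u x) /\<^sub>R s - t *\<^sub>R C x) \<le> \<epsilon> * \<bar>t\<bar>"
    proof -
      have "\<forall>\<^sub>F s in at 0. s \<noteq> 0 \<and> \<bar>s\<bar> < r / N"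
        unfolding eventually_at using r(1) N by (intro exI[of _ "r / N"]) auto
      then show ?thesis
      proof (rule eventually_mono)
        fix s assume s: "s \<noteq> 0 \<and> \<bar>s\<bar> < r / N"
        have "(u (x + t *\<^sub>R e + s *\<^sub>R d) - u (x + t *\<^sub>R e)) /\<^sub>R s - (u (x + s *\<^sub>R d) - u x) /\<^sub>R s - t *\<^sub>R C x
            = (\<phi> s t - \<phi> s 0) /\<^sub>R s"
          using s by (simp add: \<phi>_def scaleR_diff_right)
        then have "norm ((u (x + t *\<^sub>R e + s *\<^sub>R d) - u (x + t *\<^sub>R e)) /\<^sub>R s
            - (u (x + s *\<^sub>R d) - u x) /\<^sub>R s - t *\<^sub>R C x) = norm (\<phi> s t - \<phi> s 0) / \<bar>s\<bar>"
          by (simp add: divide_inverse mult.commute)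
        also have "\<dots> \<le> \<epsilon> * \<bar>t\<bar>"
          using bound[of s] s by (simp add: field_simps)
        finally show "norm ((u (x + t *\<^sub>R e + s *\<^sub>R d) - u (x + t *\<^sub>R e)) /\<^sub>R s
            - (u (x + s *\<^sub>R d) - u x) /\<^sub>R s - t *\<^sub>R C x) \<le> \<epsilon> * \<bar>t\<bar>" .
      qed
    qed
    ultimately have "norm (A (x + t *\<^sub>R e) - A x - t *\<^sub>R C x) \<le> \<epsilon> * \<bar>t\<bar>"
      by (intro tendsto_upperbound) auto
    then show "norm (A (x + t *\<^sub>R e) - A (x + 0 *\<^sub>R e) - (t - 0) *\<^sub>R C x) \<le> \<epsilon> * norm (t - 0)"
      by simp
  qed
qed

text \<open>Moving from \<open>x\<close> to \<open>y\<close> one coordinate at a time, each move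
  \<open>h $ i\<close> costs an error of at most \<open>\<epsilon> / c * \<bar>h $ i\<bar>\<close>,
  and the l1 norm of \<open>h\<close> is at most \<open>c\<close> times its Euclidean norm.\<close>

lemma has_derivative_continuous_partials:
  fixes u :: "real^'n \<Rightarrow> 'b::real_normed_vector"
  assumes "open U" "x \<in> U"
    and A: "\<And>i y. y \<in> U \<Longrightarrow> has_dir_deriv u (axis i 1) y (A i y)"
    and cont: "\<And>i. continuous_on U (A i)"
  shows "(u has_derivative (\<lambda>h. \<Sum>i\<in>UNIV. h $ i *\<^sub>R A i x)) (at x)"
  unfolding has_derivative_at_alt
proof (intro conjI allI impI)
  show "bounded_linear (\<lambda>h. \<Sum>i\<in>UNIV. h $ i *\<^sub>R A i x)"
    by (intro bounded_linear_sum bounded_linear_compose[OF bounded_linear_scaleR_left] bounded_linear_vec_nth)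
  fix \<epsilon> :: real assume \<epsilon>: "\<epsilon> > 0"
  define c where "c = real CARD('n)"
  have c: "c > 0" by (simp add: c_def)
  have "\<forall>\<^sub>F y in nhds x. y \<in> U"
    using assms(1,2) by (rule eventually_nhds_in_open)
  moreover have "\<forall>\<^sub>F y in nhds x. \<forall>i. dist (A i y) (A i x) < \<epsilon> / c"
  proof (rule eventually_all_finite)
    fix i
    have "isCont (A i) x"
      using cont assms(1,2) by (simp add: continuous_on_eq_continuous_at)
    then show "\<forall>\<^sub>F y in nhds x. dist (A i y) (A i x) < \<epsilon> / c"
      using \<epsilon> c by (intro tendstoD) (auto simp: isCont_def tendsto_at_iff_tendsto_nhds)
  qed
  ultimately have "\<forall>\<^sub>F y in nhds x. y \<in> U \<and> (\<forall>i. dist (A i y) (A i x) < \<epsilon> / c)"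
    by (rule eventually_conj)
  then obtain r where "r > 0" and r': "\<And>y. dist y x < r \<Longrightarrow> y \<in> U \<and> (\<forall>i. dist (A i y) (A i x) < \<epsilon> / c)"
    unfolding eventually_nhds_metric by blast
  then have r: "r > 0" "\<And>y. y \<in> ball x r \<Longrightarrow> y \<in> U"
      "\<And>y i. y \<in> ball x r \<Longrightarrow> norm (A i y - A i x) \<le> \<epsilon> / c"
    by (auto simp: dist_norm norm_minus_commute less_imp_le)
  show "\<exists>\<delta>>0. \<forall>y. norm (y - x) < \<delta> \<longrightarrow>
      norm (u y - u x - (\<Sum>i\<in>UNIV. (y - x) $ i *\<^sub>R A i x)) \<le> \<epsilon> * norm (y - x)"
  proof (intro exI[of _ "r / c"] conjI allI impI)
    show "r / c > 0" using r(1) c by simp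
    fix y assume y: "norm (y - x) < r / c"
    define h where "h = y - x"
    have comp: "\<bar>h $ i\<bar> \<le> norm h" for i by (rule component_le_norm_cart)
    have l1: "(\<Sum>i\<in>I. \<bar>h $ i\<bar>) \<le> c * norm h" for I
    proof -
      have "(\<Sum>i\<in>I. \<bar>h $ i\<bar>) \<le> (\<Sum>i\<in>UNIV. \<bar>h $ i\<bar>)" by (rule sum_mono2) auto
      also have "\<dots> \<le> (\<Sum>i\<in>(UNIV::'n set). norm h)" by (rule sum_mono) (rule comp)
      finally show ?thesis by (simp add: c_def)
    qed
    have mem: "x + (\<Sum>i\<in>I. h $ i *\<^sub>R axis i 1) \<in> ball x r" for I
    proof -
      have "norm (\<Sum>i\<in>I. h $ i *\<^sub>R axis i 1 :: real^'n) \<le> (\<Sum>i\<in>I. \<bar>h $ i\<bar>)"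
        by (rule order.trans[OF norm_sum]) (simp add: norm_axis_1)
      also have "\<dots> < r" using l1[of I] y c by (simp add: h_def field_simps)
      finally show ?thesis by (simp add: dist_norm)
    qed
    \<comment> \<open>Induction on the set of coordinates that have already been moved.\<close>
    have approx: "norm (u (x + (\<Sum>i\<in>I. h $ i *\<^sub>R axis i 1)) - u x - (\<Sum>i\<in>I. h $ i *\<^sub>R A i x))
        \<le> (\<Sum>i\<in>I. \<epsilon> / c * \<bar>h $ i\<bar>)" for I
    proof (induction I rule: infinite_finite_induct)
      case (insert j I)
      define z where "z = x + (\<Sum>i\<in>I. h $ i *\<^sub>R axis i 1)"
      have zj: "x + (\<Sum>i\<in>insert j I. h $ i *\<^sub>R axis i 1) = z + h $ j *\<^sub>R axis j 1"
        using insert by (simp add: z_def add_ac)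
      have "norm (u (z + h $ j *\<^sub>R axis j 1) - u z - h $ j *\<^sub>R A j x) \<le> \<epsilon> / c * \<bar>h $ j\<bar>"
        by (rule dir_deriv_linear_approx[where A = "A j" and x = x and r = r])
           (use A r mem[of I] mem[of "insert j I"] in \<open>auto simp: zj simp flip: z_def\<close>)
      moreover have "u (z + h $ j *\<^sub>R axis j 1) - u x - (h $ j *\<^sub>R A j x + (\<Sum>i\<in>I. h $ i *\<^sub>R A i x))
          = (u (z + h $ j *\<^sub>R axis j 1) - u z - h $ j *\<^sub>R A j x) + (u z - u x - (\<Sum>i\<in>I. h $ i *\<^sub>R A i x))"
        by simp
      ultimately have "norm (u (z + h $ j *\<^sub>R axis j 1) - u x - (h $ j *\<^sub>R A j x + (\<Sum>i\<in>I. h $ i *\<^sub>R A i x)))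
          \<le> \<epsilon> / c * \<bar>h $ j\<bar> + (\<Sum>i\<in>I. \<epsilon> / c * \<bar>h $ i\<bar>)"
        using insert.IH by (simp only: norm_triangle_mono flip: z_def)
      then show ?case
        unfolding zj using insert(1,2) by simp
    qed auto
    have "x + (\<Sum>i\<in>UNIV. h $ i *\<^sub>R axis i 1) = y"
      using basis_expansion[of h] by (simp add: h_def scalar_mult_eq_scaleR)
    then have "norm (u y - u x - (\<Sum>i\<in>UNIV. h $ i *\<^sub>R A i x)) \<le> (\<Sum>i\<in>UNIV. \<epsilon> / c * \<bar>h $ i\<bar>)"
      using approx[of UNIV] by simp
    also have "\<dots> = \<epsilon> / c * (\<Sum>i\<in>UNIV. \<bar>h $ i\<bar>)" by (simp add: sum_distrib_left)
    also have "\<dots> \<le> \<epsilon> / c * (c * norm h)" using \<epsilon> c l1 by (intro mult_left_mono) auto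
    finally show "norm (u y - u x - (\<Sum>i\<in>UNIV. (y - x) $ i *\<^sub>R A i x)) \<le> \<epsilon> * norm (y - x)"
      using c by (simp add: h_def)
  qed
qed

section \<open>Partial derivatives along multi-indices\<close>

fun up :: "3 \<Rightarrow> nat \<times> nat \<times> nat \<Rightarrow> nat \<times> nat \<times> nat" where
  "up i (a, b, c) = (if i = 1 then (Suc a, b, c) else if i = 2 then (a, Suc b, c) else (a, b, Suc c))"

text \<open>Truncated subtraction makes this the inverse of \<open>up\<close> only on indices
  satisfying \<open>has_index\<close>, hence the guards in the sums below.\<close>

fun dn :: "3 \<Rightarrow> nat \<times> nat \<times> nat \<Rightarrow> nat \<times> nat \<times> nat" where
  "dn i (a, b, c) = (if i = 1 then (a - 1, b, c) else if i = 2 then (a, b - 1, c) else (a, b, c - 1))"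

fun has_index :: "3 \<Rightarrow> nat \<times> nat \<times> nat \<Rightarrow> bool" where
  "has_index i (a, b, c) \<longleftrightarrow> 0 < (if i = 1 then a else if i = 2 then b else c)"

lemma dn_up [simp]: "dn i (up i \<beta>) = \<beta>"
  by (cases \<beta>) auto

lemma up_dn [simp]: "has_index i \<beta> \<Longrightarrow> up i (dn i \<beta>) = \<beta>"
  by (cases \<beta>) (auto split: if_splits)

lemma has_index_up [simp]: "has_index i (up i \<beta>)"
  by (cases \<beta>) auto

lemma mord_up [simp]: "mord (up i \<beta>) = Suc (mord \<beta>)"
  by (cases \<beta>) (auto simp: mord_def)

lemma mord_dn: "has_index i \<beta> \<Longrightarrow> mord \<beta> = Suc (mord (dn i \<beta>))"
  by (metis mord_up up_dn)

lemma finite_mord_less [simp]: "finite {\<beta>. mord \<beta> < m}"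
  by (rule finite_subset[of _ "{..<m} \<times> {..<m} \<times> {..<m}"]) (auto simp: mord_def)

lemma finite_mord_eq [simp]: "finite {\<beta>. mord \<beta> = m}"
  by (rule finite_subset[OF _ finite_mord_less[of "Suc m"]]) auto

lemma Bk_eq: "Bk k = {\<beta>. mord \<beta> < Suc k}"
  by (auto simp: Bk_def)

text \<open>\<open>F\<close> receives the raised and the original index separately, because
  coefficients belong to \<beta> while the derivative they multiply belongs to
  \<open>up i \<beta>\<close>.\<close>

lemma sum_up_reindex:
  fixes F :: "nat \<times> nat \<times> nat \<Rightarrow> nat \<times> nat \<times> nat \<Rightarrow> 'a::comm_monoid_add"
  assumes "finite A" "finite B" "\<And>\<beta>. \<beta> \<in> A \<Longrightarrow> up i \<beta> \<in> B"
    and "\<And>\<beta>. \<beta> \<in> B \<Longrightarrow> has_index i \<beta> \<Longrightarrow> dn i \<beta> \<in> A"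
  shows "(\<Sum>\<beta>\<in>A. F (up i \<beta>) \<beta>) = (\<Sum>\<beta>\<in>B. if has_index i \<beta> then F \<beta> (dn i \<beta>) else 0)"
proof -
  have "(\<Sum>\<beta>\<in>A. F (up i \<beta>) \<beta>) = (\<Sum>\<beta>\<in>{\<beta>\<in>B. has_index i \<beta>}. F \<beta> (dn i \<beta>))"
    by (rule sum.reindex_bij_witness[of _ "dn i" "up i"]) (use assms in auto)
  then show ?thesis
    using assms(2) by (simp add: sum.inter_filter)
qed

lemma dir_axis: "dir (Suc 0) = axis 1 1" "dir 2 = axis 2 1" "dir 3 = axis 3 1"
  by (auto simp: dir_def vec_eq_iff axis_def forall_3)

lemma pd_has_dir_deriv:
  assumes "pd_exists i u x"
  shows "has_dir_deriv u (dir i) x (pd i u x)"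
  using assms unfolding pd_exists_def pd_def by (simp add: vector_derivative_works)

text \<open>The head of the list is the outermost derivative. Only in these cases does
  \<open>Ck\<close> provide the next derivative directly; the others require commuting
  derivatives.\<close>

lemma canon_cases:
  "canon (Suc a, b, c) = 1 # canon (a, b, c)"
  "canon (0, Suc b, c) = 2 # canon (0, b, c)"
  "canon (0, 0, Suc c) = 3 # canon (0, 0, c)"
  by (auto simp: canon_def)

context
  fixes U :: "(real^3) set" and k :: nat and g :: "real^3 \<Rightarrow> complex"
  assumes U: "open U" and Ck: "Ck U k g"
begin

lemma Ck_head_deriv:
  assumes "canon \<beta> = i # canon \<gamma>" "mord \<beta> \<le> k" "x \<in> U"
  shows "has_dir_deriv (Dm \<gamma> g) (dir i) x (Dm \<beta> g x)"
proof -
  have "pd_exists i (iterd (canon \<gamma>) g) x"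
    using Ck assms unfolding Ck_def Bk_def by blast
  then show ?thesis
    using pd_has_dir_deriv assms(1) by (simp add: Dm_def)
qed

lemma Dm_continuous_on: "mord \<beta> \<le> k \<Longrightarrow> continuous_on U (Dm \<beta> g)"
  using Ck unfolding Ck_def Bk_def by (blast intro: uniformly_continuous_imp_continuous)

text \<open>Schwarz's theorem moves a derivative along \<open>e\<close> inwards past the common
  outermost derivative \<open>i\<close>; the order bound on \<open>\<beta>'\<close> supplies the
  continuity of the mixed derivative.\<close>

lemma has_dir_deriv_swap_step:
  assumes "canon \<beta> = i # canon \<gamma>" "canon \<beta>' = i # canon \<gamma>'" "mord \<beta> \<le> k" "mord \<beta>' \<le> k"
    and "\<And>y. y \<in> U \<Longrightarrow> has_dir_deriv (Dm \<gamma> g) e y (Dm \<gamma>' g y)" "x \<in> U"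
  shows "has_dir_deriv (Dm \<beta> g) e x (Dm \<beta>' g x)"
  by (rule mixed_partial_swap[OF U \<open>x \<in> U\<close>, where u = "Dm \<gamma> g" and B = "Dm \<gamma>' g" and d = "dir i"])
     (use assms Ck_head_deriv Dm_continuous_on in auto)

text \<open>\<open>Ck\<close> speaks of derivatives in canonical order only, so the new derivative
  is moved past those of smaller direction: direction 3 past all 2s and then all 1s, direction 2
  past all 1s, direction 1 past none.\<close>

lemma Dm_dir_deriv:
  assumes "mord \<beta> < k" "x \<in> U"
  shows "has_dir_deriv (Dm \<beta> g) (axis i 1) x (Dm (up i \<beta>) g x)"
proof -
  obtain a b c where \<beta>: "\<beta> = (a, b, c)" by (cases \<beta>)
  have d3_0: "has_dir_deriv (Dm (0, b, c) g) (axis 3 1) x (Dm (0, b, Suc c) g x)"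
    if "b + c < k" "x \<in> U" for x b
    using that
  proof (induction b arbitrary: x)
    case 0
    then show ?case
      using Ck_head_deriv[OF canon_cases(3), of c x] by (simp add: mord_def dir_axis)
  next
    case (Suc b)
    show ?case
      by (rule has_dir_deriv_swap_step[OF canon_cases(2) canon_cases(2)])
         (use Suc in \<open>auto simp: mord_def\<close>)
  qed
  have d3: "has_dir_deriv (Dm (a, b, c) g) (axis 3 1) x (Dm (a, b, Suc c) g x)"
    if "a + b + c < k" "x \<in> U" for x a
    using that
  proof (induction a arbitrary: x)
    case 0
    then show ?case using d3_0 by simp
  next
    case (Suc a)
    show ?case
      by (rule has_dir_deriv_swap_step[OF canon_cases(1) canon_cases(1)])
         (use Suc in \<open>auto simp: mord_def\<close>)
  qed
  have d2: "has_dir_deriv (Dm (a, b, c) g) (axis 2 1) x (Dm (a, Suc b, c) g x)"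
    if "a + b + c < k" "x \<in> U" for x a
    using that
  proof (induction a arbitrary: x)
    case 0
    then show ?case
      using Ck_head_deriv[OF canon_cases(2), of b c x] by (simp add: mord_def dir_axis)
  next
    case (Suc a)
    show ?case
      by (rule has_dir_deriv_swap_step[OF canon_cases(1) canon_cases(1)])
         (use Suc in \<open>auto simp: mord_def\<close>)
  qed
  have d1: "has_dir_deriv (Dm (a, b, c) g) (axis 1 1) x (Dm (Suc a, b, c) g x)"
    using Ck_head_deriv[OF canon_cases(1), of a b c x] assms by (simp add: mord_def dir_axis \<beta>)
  from d1 d2[of a x] d3[of a x] assms show ?thesis
    using exhaust_3[of i] by (auto simp: \<beta> mord_def)
qed

text \<open>The strict bound on the order makes the first partials of \<open>Dm \<beta> g\<close>
  continuous, hence \<open>Dm \<beta> g\<close> totally differentiable.\<close>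

lemma Dm_chain_rule:
  assumes "mord \<beta> < k" "c t \<in> U" "\<And>i. ((\<lambda>t. c t $ i) has_real_derivative c' i) (at t)"
  shows "((\<lambda>t. Dm \<beta> g (c t)) has_vector_derivative (\<Sum>i\<in>UNIV. c' i *\<^sub>R Dm (up i \<beta>) g (c t))) (at t)"
proof -
  have "(Dm \<beta> g has_derivative (\<lambda>h. \<Sum>i\<in>UNIV. h $ i *\<^sub>R Dm (up i \<beta>) g (c t))) (at (c t))"
    by (rule has_derivative_continuous_partials[OF U])
       (use assms Dm_dir_deriv Dm_continuous_on in auto)
  moreover have "(c has_vector_derivative (\<chi> i. c' i)) (at t)"
    unfolding has_vector_derivative_def has_derivative_componentwise_within[of c]
    using assms(3)
    by (auto simp: Basis_vec_def inner_axis has_field_derivative_def mult.commute[of _ "c' _"])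
  ultimately have "((\<lambda>t. Dm \<beta> g (c t)) has_derivative
      (\<lambda>s. \<Sum>i\<in>UNIV. (s *\<^sub>R (\<chi> i. c' i)) $ i *\<^sub>R Dm (up i \<beta>) g (c t))) (at t)"
    unfolding has_vector_derivative_def by (rule has_derivative_compose[rotated])
  then show ?thesis
    by (simp add: has_vector_derivative_def scaleR_sum_right)
qed

end

section \<open>Higher derivatives along circles\<close>

text \<open>\<open>trig_poly c d\<close> holds of sums of \<open>c\<close> products of \<open>d\<close> factors \<open>r cos (t + p)\<close> with
  \<open>\<bar>r\<bar> \<le> 1\<close>; differentiation multiplies \<open>c\<close> by \<open>d\<close>.\<close>

inductive trig_poly :: "nat \<Rightarrow> nat \<Rightarrow> (real \<Rightarrow> real) \<Rightarrow> bool" where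
  one: "trig_poly 1 0 (\<lambda>t. 1)"
| zero: "trig_poly 0 d (\<lambda>t. 0)"
| add: "trig_poly c d P \<Longrightarrow> trig_poly c' d P' \<Longrightarrow> trig_poly (c + c') d (\<lambda>t. P t + P' t)"
| mult: "trig_poly c d P \<Longrightarrow> \<bar>r\<bar> \<le> 1 \<Longrightarrow> trig_poly c (Suc d) (\<lambda>t. r * cos (t + p) * P t)"

lemma trig_poly_bound: "trig_poly c d P \<Longrightarrow> \<bar>P t\<bar> \<le> real c"
proof (induction rule: trig_poly.induct)
  case (add c d P c' P')
  then show ?case by simp
next
  case (mult c d P r p)
  have "\<bar>r * cos (t + p) * P t\<bar> \<le> (1 * 1) * real c"
    unfolding abs_mult using mult by (intro mult_mono) auto
  then show ?case by simp
qed auto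

lemma trig_poly_deriv_ex:
  "trig_poly c d P \<Longrightarrow> \<exists>P'. (\<forall>t. (P has_real_derivative P' t) (at t)) \<and> trig_poly (d * c) d P'"
proof (induction rule: trig_poly.induct)
  case one
  then show ?case using zero by (intro exI[of _ "\<lambda>t. 0"]) auto
next
  case (zero d)
  then show ?case using trig_poly.zero by (intro exI[of _ "\<lambda>t. 0"]) auto
next
  case (add c d P c' P')
  then obtain Q Q' where Q: "\<And>t. (P has_real_derivative Q t) (at t)" "trig_poly (d * c) d Q"
    "\<And>t. (P' has_real_derivative Q' t) (at t)" "trig_poly (d * c') d Q'" by blast
  show ?case
    using trig_poly.add[OF Q(2,4)] Q(1,3)
    by (intro exI[of _ "\<lambda>t. Q t + Q' t"]) (auto intro!: DERIV_add simp: algebra_simps)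
next
  case (mult c d P r p)
  then obtain Q where Q: "\<And>t. (P has_real_derivative Q t) (at t)" "trig_poly (d * c) d Q" by blast
  \<comment> \<open>The derivative of a cosine factor is the same factor with phase advanced by
    \<open>pi / 2\<close>, so the product rule stays within the class; the count is
    \<open>Suc d * c\<close>.\<close>
  have "trig_poly (c + d * c) (Suc d) (\<lambda>t. r * cos (t + (p + pi / 2)) * P t + r * cos (t + p) * Q t)"
    by (intro trig_poly.add trig_poly.mult mult Q)
  moreover have "((\<lambda>t. r * cos (t + p) * P t) has_real_derivative
      r * cos (t + (p + pi / 2)) * P t + r * cos (t + p) * Q t) (at t)" for t
    by (auto intro!: derivative_eq_intros Q simp: cos_add algebra_simps)
       (simp add: sin_add algebra_simps)
  ultimately show ?case
    by (intro exI[of _ "\<lambda>t. r * cos (t + (p + pi / 2)) * P t + r * cos (t + p) * Q t"]) simp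
qed

lemma trig_poly_deriv:
  assumes "trig_poly c d P"
  shows "(P has_real_derivative deriv P t) (at t)" "trig_poly (d * c) d (deriv P)"
proof -
  obtain P' where P': "\<And>t. (P has_real_derivative P' t) (at t)" "trig_poly (d * c) d P'"
    using trig_poly_deriv_ex[OF assms] by blast
  then have "deriv P = P'" by (auto intro: DERIV_imp_deriv)
  then show "(P has_real_derivative deriv P t) (at t)" "trig_poly (d * c) d (deriv P)"
    using P' by auto
qed

text \<open>\<open>chain_count m \<beta>\<close> bounds the number of products in the coefficient of \<open>D\<^sup>\<beta> g\<close> in the
  \<open>m\<close>-th derivative of \<open>g\<close> along a curve.\<close>

primrec chain_count :: "nat \<Rightarrow> nat \<times> nat \<times> nat \<Rightarrow> nat" where
  "chain_count 0 \<beta> = (if \<beta> = (0, 0, 0) then 1 else 0)"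
| "chain_count (Suc m) \<beta> = mord \<beta> * chain_count m \<beta>
     + (\<Sum>i\<in>UNIV. if has_index i \<beta> then chain_count m (dn i \<beta>) else 0)"

lemma chain_count_eq_0: "m < mord \<beta> \<Longrightarrow> chain_count m \<beta> = 0"
proof (induction m arbitrary: \<beta>)
  case (Suc m)
  have "chain_count m (dn i \<beta>) = 0" if "has_index i \<beta>" for i
    using Suc mord_dn[OF that] by simp
  then show ?case using Suc by simp
qed (auto simp: mord_def)

text \<open>The index itself contributes at most \<open>m\<close> times the old bound, since its
  count vanishes above order \<open>m\<close>, and the lowered indices three times:
  \<open>(m + 3) * (m + 2)! = (m + 3)!\<close>. The factor 2 is exact at the start, where
  \<open>2 * 1 = 2!\<close>.\<close>

lemma chain_count_le: "2 * chain_count m \<beta> \<le> fact (m + 2)"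
proof (induction m arbitrary: \<beta>)
  case (Suc m)
  have "mord \<beta> * chain_count m \<beta> \<le> m * chain_count m \<beta>"
    by (cases "mord \<beta> \<le> m") (auto simp: chain_count_eq_0)
  also have "2 * \<dots> \<le> m * fact (m + 2)" using Suc[of \<beta>] by simp
  finally have 1: "2 * (mord \<beta> * chain_count m \<beta>) \<le> m * fact (m + 2)" by simp
  have "2 * (\<Sum>i\<in>UNIV. if has_index i \<beta> then chain_count m (dn i \<beta>) else 0) \<le> (\<Sum>i\<in>(UNIV::3 set). fact (m + 2))"
    unfolding sum_distrib_left by (rule sum_mono) (use Suc in auto)
  with 1 show ?case by (simp add: algebra_simps)
qed simp

text \<open>At top order no derivative falls on a coefficient, so the counts are multinomial
  coefficients: they count words of length \<open>m\<close> in three letters.\<close>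

lemma sum_chain_count_top: "(\<Sum>\<beta>\<in>{\<beta>. mord \<beta> = m}. chain_count m \<beta>) = 3 ^ m"
proof (induction m)
  case 0
  have "{\<beta>. mord \<beta> = 0} = {(0, 0, 0)}" by (auto simp: mord_def)
  then show ?case by simp
next
  case (Suc m)
  have "(\<Sum>\<beta>\<in>{\<beta>. mord \<beta> = Suc m}. chain_count (Suc m) \<beta>)
      = (\<Sum>\<beta>\<in>{\<beta>. mord \<beta> = Suc m}. \<Sum>i\<in>UNIV. if has_index i \<beta> then chain_count m (dn i \<beta>) else 0)"
    by (rule sum.cong) (auto simp: chain_count_eq_0)
  also have "\<dots> = (\<Sum>i\<in>UNIV. \<Sum>\<beta>\<in>{\<beta>. mord \<beta> = Suc m}. if has_index i \<beta> then chain_count m (dn i \<beta>) else 0)"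
    by (rule sum.swap)
  also have "\<dots> = (\<Sum>i\<in>(UNIV::3 set). 3 ^ m)"
  proof (rule sum.cong)
    fix i :: 3
    show "(\<Sum>\<beta>\<in>{\<beta>. mord \<beta> = Suc m}. if has_index i \<beta> then chain_count m (dn i \<beta>) else 0) = 3 ^ m"
      unfolding Suc[symmetric]
      by (rule sum_up_reindex[where F = "\<lambda>_. chain_count m", symmetric]) (auto simp: mord_dn)
  qed simp
  finally show ?case by simp
qed

text \<open>Absorbs the \<open>3 ^ k\<close> top-order products together with the Lipschitz constant
  3 of the circle into the factorial of the final bound.\<close>

lemma three_power_le_fact: "3 ^ Suc k \<le> (fact (k + 3) :: real)"
proof (induction k)
  case (Suc k)
  have "(3::real) ^ Suc (Suc k) \<le> 3 * fact (k + 3)" using Suc by simp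
  also have "\<dots> \<le> (real k + 4) * fact (k + 3)" by (intro mult_right_mono) auto
  also have "\<dots> = fact (Suc k + 3)" by (simp only: add_Suc fact_Suc) simp
  finally show ?case .
qed (simp add: fact_numeral)

text \<open>The coefficient of \<open>D\<^sup>\<beta> g\<close> in the \<open>m\<close>-th
  derivative along the curve with coordinates \<open>\<rho> $ i * cos (t + \<phi> $ i)\<close> up to
  constants. The first summand is the product rule, the sum the chain rule; the phase
  \<open>pi / 2\<close> comes from differentiating the cosine.\<close>

primrec chain_coeff :: "real^3 \<Rightarrow> real^3 \<Rightarrow> nat \<Rightarrow> nat \<times> nat \<times> nat \<Rightarrow> real \<Rightarrow> real" where
  "chain_coeff \<rho> \<phi> 0 \<beta> = (\<lambda>t. if \<beta> = (0, 0, 0) then 1 else 0)"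
| "chain_coeff \<rho> \<phi> (Suc m) \<beta> = (\<lambda>t. deriv (chain_coeff \<rho> \<phi> m \<beta>) t
     + (\<Sum>i\<in>UNIV. if has_index i \<beta> then \<rho> $ i * cos (t + (\<phi> $ i + pi / 2)) * chain_coeff \<rho> \<phi> m (dn i \<beta>) t else 0))"

text \<open>The recursions of \<open>chain_count\<close> and \<open>chain_coeff\<close> run in
  parallel; raising the index by one adds exactly one sinusoidal factor, so the degree is
  \<open>mord \<beta>\<close>.\<close>

lemma trig_poly_chain_coeff:
  assumes "\<And>i. \<bar>\<rho> $ i\<bar> \<le> 1"
  shows "trig_poly (chain_count m \<beta>) (mord \<beta>) (chain_coeff \<rho> \<phi> m \<beta>)"
proof (induction m arbitrary: \<beta>)
  case 0
  show ?case
    using trig_poly.one trig_poly.zero[of "mord \<beta>"] by (auto simp: mord_def)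
next
  case (Suc m)
  have "trig_poly (if has_index i \<beta> then chain_count m (dn i \<beta>) else 0) (mord \<beta>)
      (\<lambda>t. if has_index i \<beta> then \<rho> $ i * cos (t + (\<phi> $ i + pi / 2)) * chain_coeff \<rho> \<phi> m (dn i \<beta>) t else 0)" for i
    using trig_poly.mult[OF Suc[of "dn i \<beta>"] assms[of i]] trig_poly.zero by (auto simp: mord_dn)
  then show ?case
    unfolding chain_count.simps chain_coeff.simps sum_3
    by (intro trig_poly.add trig_poly_deriv(2)[OF Suc])
qed

section \<open>Derivatives of an extension along a circle on the sphere\<close>

definition circ :: "real^3 \<Rightarrow> real^3 \<Rightarrow> real^3 \<Rightarrow> real \<Rightarrow> real^3" where
  "circ \<kappa> \<rho> \<phi> t = (\<chi> i. \<kappa> $ i + \<rho> $ i * cos (t + \<phi> $ i))"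

locale Ck_on_circle =
  fixes U :: "(real^3) set" and k :: nat and g :: "real^3 \<Rightarrow> complex" and \<kappa> \<rho> \<phi> :: "real^3"
  assumes U: "open U" "S2 \<subseteq> U" and Ck: "Ck U k g"
    and \<rho>: "\<And>i. \<bar>\<rho> $ i\<bar> \<le> 1" and circ_S2: "\<And>t. circ \<kappa> \<rho> \<phi> t \<in> S2"
begin

abbreviation "\<gamma> \<equiv> circ \<kappa> \<rho> \<phi>"
abbreviation "\<gamma>' i t \<equiv> \<rho> $ i * cos (t + (\<phi> $ i + pi / 2))"
abbreviation "Q \<equiv> chain_coeff \<rho> \<phi>"

definition Dsup :: "nat \<times> nat \<times> nat \<Rightarrow> real" where
  "Dsup \<beta> = Sup ((\<lambda>x. cmod (Dm \<beta> g x)) ` S2)"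

text \<open>For \<open>m \<le> k\<close> this is the \<open>m\<close>-th derivative of
  \<open>g\<close> along the circle, by \<open>h_0\<close> and \<open>h_deriv\<close>.\<close>

definition h :: "nat \<Rightarrow> real \<Rightarrow> complex" where
  "h m t = (\<Sum>\<beta>\<in>{\<beta>. mord \<beta> < Suc m}. Q m \<beta> t *\<^sub>R Dm \<beta> g (\<gamma> t))"

lemma circ_deriv: "((\<lambda>t. \<gamma> t $ i) has_real_derivative \<gamma>' i t) (at t)"
  by (auto simp: circ_def cos_add sin_add intro!: derivative_eq_intros)

text \<open>Each of the three coordinates is 1-Lipschitz; the crude constant 3 is affordable in the
  final factorial.\<close>

lemma circ_lipschitz: "norm (\<gamma> s - \<gamma> t) \<le> 3 * \<bar>s - t\<bar>"
proof -
  have "\<bar>\<gamma> s $ i - \<gamma> t $ i\<bar> \<le> 1 * \<bar>s - t\<bar>" for i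
  proof -
    have "norm (\<gamma> s $ i - \<gamma> t $ i) \<le> 1 * \<bar>s - t\<bar>"
    proof (rule norm_diff_le_vector_derivative[where f' = "\<gamma>' i"])
      show "((\<lambda>t. \<gamma> t $ i) has_vector_derivative \<gamma>' i t) (at t)" for t
        using circ_deriv by (simp add: has_real_derivative_iff_has_vector_derivative)
      show "norm (\<gamma>' i t) \<le> 1" for t
        using mult_mono[OF \<rho>[of i] abs_cos_le_one[of "t + (\<phi> $ i + pi / 2)"]] by (simp add: abs_mult)
    qed
    then show ?thesis by simp
  qed
  then have "(\<Sum>i\<in>UNIV. \<bar>(\<gamma> s - \<gamma> t) $ i\<bar>) \<le> (\<Sum>i\<in>(UNIV::3 set). \<bar>s - t\<bar>)"
    by (intro sum_mono) simp
  then show ?thesis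
    using norm_le_l1_cart[of "\<gamma> s - \<gamma> t"] by simp
qed

lemma circ_U: "\<gamma> t \<in> U"
  using circ_S2 U by blast

lemma continuous_circ: "continuous_on A \<gamma>"
  unfolding circ_def by (intro continuous_intros)

lemma Dsup_upper:
  assumes "mord \<beta> \<le> k" "x \<in> S2"
  shows "cmod (Dm \<beta> g x) \<le> Dsup \<beta>"
  unfolding Dsup_def
proof (rule cSup_upper)
  have "bounded (Dm \<beta> g ` U)"
    using Ck assms(1) unfolding Ck_def Bk_def by blast
  then obtain B where "\<And>x. x \<in> U \<Longrightarrow> cmod (Dm \<beta> g x) \<le> B"
    unfolding bounded_iff by auto
  then show "bdd_above ((\<lambda>x. cmod (Dm \<beta> g x)) ` S2)"
    using U(2) by (intro bdd_aboveI[of _ B]) auto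
qed (use assms in auto)

lemma Dsup_nonneg: "mord \<beta> \<le> k \<Longrightarrow> 0 \<le> Dsup \<beta>"
  using Dsup_upper[OF _ circ_S2[of 0]] norm_ge_zero order.trans by blast

lemma trig_poly_Q: "trig_poly (chain_count m \<beta>) (mord \<beta>) (Q m \<beta>)"
  using \<rho> by (rule trig_poly_chain_coeff)

lemma Q_deriv: "(Q m \<beta> has_real_derivative deriv (Q m \<beta>) t) (at t)"
  by (rule trig_poly_deriv[OF trig_poly_Q])

lemma Q_bound: "\<bar>Q m \<beta> t\<bar> \<le> chain_count m \<beta>"
  by (rule trig_poly_bound[OF trig_poly_Q])

lemma Q_deriv_bound: "\<bar>deriv (Q m \<beta>) t\<bar> \<le> mord \<beta> * chain_count m \<beta>"
  using trig_poly_bound[OF trig_poly_deriv(2)[OF trig_poly_Q]] by simp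

lemma Q_eq_0: "m < mord \<beta> \<Longrightarrow> Q m \<beta> = (\<lambda>t. 0)"
  using Q_bound[of m \<beta>] by (auto simp: chain_count_eq_0)

lemma Q_term_deriv:
  assumes "mord \<beta> < k"
  shows "((\<lambda>t. Q m \<beta> t *\<^sub>R Dm \<beta> g (\<gamma> t)) has_vector_derivative
    (deriv (Q m \<beta>) t *\<^sub>R Dm \<beta> g (\<gamma> t) + (\<Sum>i\<in>UNIV. (\<gamma>' i t * Q m \<beta> t) *\<^sub>R Dm (up i \<beta>) g (\<gamma> t)))) (at t)"
proof -
  have "((\<lambda>t. Dm \<beta> g (\<gamma> t)) has_vector_derivative (\<Sum>i\<in>UNIV. \<gamma>' i t *\<^sub>R Dm (up i \<beta>) g (\<gamma> t))) (at t)"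
    by (rule Dm_chain_rule[OF U(1) Ck assms circ_U circ_deriv])
  from has_vector_derivative_scaleR[OF Q_deriv[of m \<beta>, of t] this]
  show ?thesis
    by (simp add: scaleR_sum_right add.commute mult.commute)
qed

lemma h_deriv:
  assumes "m < k"
  shows "(h m has_vector_derivative h (Suc m) t) (at t)"
proof -
  have "((\<lambda>t. \<Sum>\<beta>\<in>{\<beta>. mord \<beta> < Suc m}. Q m \<beta> t *\<^sub>R Dm \<beta> g (\<gamma> t)) has_vector_derivative
    (\<Sum>\<beta>\<in>{\<beta>. mord \<beta> < Suc m}. deriv (Q m \<beta>) t *\<^sub>R Dm \<beta> g (\<gamma> t)
       + (\<Sum>i\<in>UNIV. (\<gamma>' i t * Q m \<beta> t) *\<^sub>R Dm (up i \<beta>) g (\<gamma> t)))) (at t)"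
    using assms by (intro has_vector_derivative_sum Q_term_deriv) auto
  moreover have "(\<Sum>\<beta>\<in>{\<beta>. mord \<beta> < Suc m}. deriv (Q m \<beta>) t *\<^sub>R Dm \<beta> g (\<gamma> t)
       + (\<Sum>i\<in>UNIV. (\<gamma>' i t * Q m \<beta> t) *\<^sub>R Dm (up i \<beta>) g (\<gamma> t))) = h (Suc m) t"
  proof -
    \<comment> \<open>Both sums are brought to the orders up to \<open>m + 1\<close>, the first by
      adding zero terms and the second by reindexing with \<open>up i\<close>; the coefficients then
      match the recursion of \<open>chain_coeff\<close>.\<close>
    have "(\<Sum>\<beta>\<in>{\<beta>. mord \<beta> < Suc m}. deriv (Q m \<beta>) t *\<^sub>R Dm \<beta> g (\<gamma> t))
        = (\<Sum>\<beta>\<in>{\<beta>. mord \<beta> < Suc (Suc m)}. deriv (Q m \<beta>) t *\<^sub>R Dm \<beta> g (\<gamma> t))"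
      by (rule sum.mono_neutral_left) (auto simp: Q_eq_0)
    moreover have "(\<Sum>\<beta>\<in>{\<beta>. mord \<beta> < Suc m}. (\<gamma>' i t * Q m \<beta> t) *\<^sub>R Dm (up i \<beta>) g (\<gamma> t))
        = (\<Sum>\<beta>\<in>{\<beta>. mord \<beta> < Suc (Suc m)}. (if has_index i \<beta> then \<gamma>' i t * Q m (dn i \<beta>) t else 0) *\<^sub>R Dm \<beta> g (\<gamma> t))" for i
    proof -
      have "(\<Sum>\<beta>\<in>{\<beta>. mord \<beta> < Suc m}. (\<gamma>' i t * Q m \<beta> t) *\<^sub>R Dm (up i \<beta>) g (\<gamma> t))
        = (\<Sum>\<beta>\<in>{\<beta>. mord \<beta> < Suc (Suc m)}. if has_index i \<beta> then (\<gamma>' i t * Q m (dn i \<beta>) t) *\<^sub>R Dm \<beta> g (\<gamma> t) else 0)"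
        by (rule sum_up_reindex[where F = "\<lambda>\<beta>' \<beta>. (\<gamma>' i t * Q m \<beta> t) *\<^sub>R Dm \<beta>' g (\<gamma> t)"]) (auto simp: mord_dn)
      also have "\<dots> = (\<Sum>\<beta>\<in>{\<beta>. mord \<beta> < Suc (Suc m)}. (if has_index i \<beta> then \<gamma>' i t * Q m (dn i \<beta>) t else 0) *\<^sub>R Dm \<beta> g (\<gamma> t))"
        by (rule sum.cong) auto
      finally show ?thesis .
    qed
    ultimately show ?thesis
      unfolding h_def sum_3 chain_coeff.simps
      by (simp only: sum.distrib scaleR_add_left)
  qed
  ultimately show ?thesis
    unfolding h_def[abs_def] by simp
qed

lemma h_bound:
  assumes "m \<le> k"
  shows "cmod (h m t) \<le> (\<Sum>\<beta>\<in>{\<beta>. mord \<beta> < Suc m}. chain_count m \<beta> * Dsup \<beta>)"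
  unfolding h_def
proof (rule order.trans[OF norm_sum], rule sum_mono)
  fix \<beta> assume "\<beta> \<in> {\<beta>. mord \<beta> < Suc m}"
  then have "mord \<beta> \<le> k" using assms by simp
  then show "cmod (Q m \<beta> t *\<^sub>R Dm \<beta> g (\<gamma> t)) \<le> chain_count m \<beta> * Dsup \<beta>"
    using Q_bound Dsup_upper circ_S2 by (simp add: mult_mono)
qed

lemma continuous_h: "m \<le> k \<Longrightarrow> continuous_on A (h m)"
  unfolding h_def[abs_def]
  by (intro continuous_intros continuous_on_compose2[OF Dm_continuous_on[OF U(1) Ck] continuous_circ]
      continuous_at_imp_continuous_on ballI DERIV_isCont[OF Q_deriv]) (use circ_U in auto)

lemma circ_periodic: "\<gamma> (t + 2 * pi) = \<gamma> t"
proof -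
  have "cos (t + 2 * pi + p) = cos (t + p)" for p
    using cos_periodic[of "t + p"] by (simp add: algebra_simps)
  then show ?thesis by (simp add: circ_def vec_eq_iff)
qed

lemma h_0: "h 0 t = g (\<gamma> t)"
proof -
  have "{\<beta>. mord \<beta> < Suc 0} = {(0, 0, 0)}" by (auto simp: mord_def)
  then show ?thesis by (simp add: h_def Dm_def canon_def)
qed

text \<open>Periodicity passes from a function to its derivative by uniqueness of derivatives, so
  the coefficients need not be inspected.\<close>

lemma h_periodic: "m \<le> k \<Longrightarrow> h m (t + 2 * pi) = h m t"
proof (induction m arbitrary: t)
  case 0
  show ?case by (simp add: h_0 circ_periodic)
next
  case (Suc m)
  have "((\<lambda>t. t + 2 * pi) has_vector_derivative 1) (at t)"
    by (auto intro!: derivative_eq_intros)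
  then have "(h m \<circ> (\<lambda>t. t + 2 * pi) has_vector_derivative 1 *\<^sub>R h (Suc m) (t + 2 * pi)) (at t)"
    by (rule vector_diff_chain_at) (use Suc h_deriv in auto)
  then have "(h m has_vector_derivative h (Suc m) (t + 2 * pi)) (at t)"
    using Suc by (simp add: o_def)
  then show ?case
    using h_deriv[of m t] Suc by (auto intro: vector_derivative_unique_at)
qed

end

section \<open>Hoelder estimate for the top derivative along the circle\<close>

lemma mord_less_Suc_split: "{\<beta>. mord \<beta> < Suc k} = {\<beta>. mord \<beta> < k} \<union> {\<beta>. mord \<beta> = k}"
  by auto

lemma sum_mord_less_Suc:
  "(\<Sum>\<beta>\<in>{\<beta>. mord \<beta> < Suc k}. F \<beta>) = (\<Sum>\<beta>\<in>{\<beta>. mord \<beta> < k}. F \<beta>) + (\<Sum>\<beta>\<in>{\<beta>. mord \<beta> = k}. F \<beta>)"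
  unfolding mord_less_Suc_split by (rule sum.union_disjoint) auto

context Ck_on_circle
begin

definition Dsum :: real where
  "Dsum = (\<Sum>\<beta>\<in>{\<beta>. mord \<beta> < Suc k}. Dsup \<beta>)"

lemma Dsum_nonneg: "0 \<le> Dsum"
  unfolding Dsum_def by (rule sum_nonneg) (auto intro: Dsup_nonneg)

text \<open>\<open>m\<close> is kept apart from \<open>k\<close> because both \<open>m = k\<close>
  and \<open>m = Suc k\<close> occur.\<close>

lemma sum_chain_count_Dsup:
  "(\<Sum>\<beta>\<in>{\<beta>. mord \<beta> < Suc k}. chain_count m \<beta> * Dsup \<beta>) \<le> fact (m + 2) / 2 * Dsum"
  unfolding Dsum_def sum_distrib_left
proof (rule sum_mono)
  fix \<beta> assume "\<beta> \<in> {\<beta>. mord \<beta> < Suc k}"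
  then have "0 \<le> Dsup \<beta>" by (auto intro: Dsup_nonneg)
  moreover have "real (2 * chain_count m \<beta>) \<le> real (fact (m + 2))"
    using chain_count_le[of m \<beta>] by (simp only: of_nat_le_iff)
  then have "real (chain_count m \<beta>) \<le> fact (m + 2) / 2"
    by (simp add: of_nat_fact del: fact_Suc)
  ultimately show "real (chain_count m \<beta>) * Dsup \<beta> \<le> fact (m + 2) / 2 * Dsup \<beta>"
    by (intro mult_right_mono)
qed

text \<open>In the difference of the \<open>k\<close>-th derivatives, freezing the factors \<open>D\<^sup>\<beta> g\<close> of top order at one
  end point leaves a differentiable function, whose derivative again obeys the counting bound.\<close>

lemma h_holder:
  assumes \<alpha>: "0 < \<alpha>" "\<alpha> \<le> 1" and \<delta>: "0 < \<delta>" and H0: "0 \<le> H"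
    and H: "\<And>\<beta> x y. mord \<beta> = k \<Longrightarrow> x \<in> S2 \<Longrightarrow> y \<in> S2 \<Longrightarrow>
      cmod (Dm \<beta> g x - Dm \<beta> g y) \<le> H * norm (x - y) powr \<alpha>"
  shows "cmod (h k (t + \<delta>) - h k t) \<le> fact (k + 3) * \<delta> powr \<alpha> * (Dsum + H)"
proof -
  \<comment> \<open>With the top-order factors frozen at \<open>t + \<delta>\<close>,
    \<open>Y\<close> agrees with \<open>h k\<close> at \<open>t + \<delta>\<close> and differs from
    it at \<open>t\<close> only in the top-order terms.\<close>
  define K where "K \<beta> = Dm \<beta> g (\<gamma> (t + \<delta>))" for \<beta>
  define Y where "Y s = (\<Sum>\<beta>\<in>{\<beta>. mord \<beta> < k}. Q k \<beta> s *\<^sub>R Dm \<beta> g (\<gamma> s))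
      + (\<Sum>\<beta>\<in>{\<beta>. mord \<beta> = k}. Q k \<beta> s *\<^sub>R K \<beta>)" for s
  define Y' where "Y' s = (\<Sum>\<beta>\<in>{\<beta>. mord \<beta> < k}. deriv (Q k \<beta>) s *\<^sub>R Dm \<beta> g (\<gamma> s)
        + (\<Sum>i\<in>UNIV. (\<gamma>' i s * Q k \<beta> s) *\<^sub>R Dm (up i \<beta>) g (\<gamma> s)))
      + (\<Sum>\<beta>\<in>{\<beta>. mord \<beta> = k}. deriv (Q k \<beta>) s *\<^sub>R K \<beta>)" for s
  have KD: "cmod (K \<beta>) \<le> Dsup \<beta>" if "mord \<beta> = k" for \<beta>
    unfolding K_def using that circ_S2 by (auto intro: Dsup_upper)
  have Y_deriv: "(Y has_vector_derivative Y' s) (at s)" for s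
  proof -
    have "((\<lambda>s. Q k \<beta> s *\<^sub>R K \<beta>) has_vector_derivative deriv (Q k \<beta>) s *\<^sub>R K \<beta>) (at s)" for \<beta>
      using has_vector_derivative_scaleR[OF Q_deriv[of k \<beta> s] has_vector_derivative_const] by simp
    then show ?thesis
      unfolding Y_def[abs_def] Y'_def
      by (intro has_vector_derivative_add has_vector_derivative_sum Q_term_deriv) auto
  qed
  have Y_bound: "cmod (Y s) \<le> fact (k + 2) / 2 * Dsum" for s
  proof -
    have "cmod (Y s) \<le> (\<Sum>\<beta>\<in>{\<beta>. mord \<beta> < k}. chain_count k \<beta> * Dsup \<beta>)
        + (\<Sum>\<beta>\<in>{\<beta>. mord \<beta> = k}. chain_count k \<beta> * Dsup \<beta>)"
      unfolding Y_def
    proof (intro norm_triangle_mono sum_norm_le)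
      fix \<beta> assume "\<beta> \<in> {\<beta>. mord \<beta> < k}"
      then show "cmod (Q k \<beta> s *\<^sub>R Dm \<beta> g (\<gamma> s)) \<le> chain_count k \<beta> * Dsup \<beta>"
        using Q_bound[of k \<beta>] Dsup_upper[of \<beta>] circ_S2 by (simp add: mult_mono)
    next
      fix \<beta> assume "\<beta> \<in> {\<beta>. mord \<beta> = k}"
      then show "cmod (Q k \<beta> s *\<^sub>R K \<beta>) \<le> chain_count k \<beta> * Dsup \<beta>"
        using Q_bound[of k \<beta>] KD by (simp add: mult_mono)
    qed
    then show ?thesis
      using sum_chain_count_Dsup[of k] by (simp add: sum_mord_less_Suc)
  qed
  have Y'_bound: "cmod (Y' s) \<le> fact (k + 3) / 2 * Dsum" for s
  proof -
    have \<gamma>': "\<bar>\<gamma>' i s\<bar> \<le> 1" for i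
      using mult_mono[OF \<rho>[of i] abs_cos_le_one[of "s + (\<phi> $ i + pi / 2)"]] by (simp add: abs_mult)
    have "cmod (Y' s) \<le> (\<Sum>\<beta>\<in>{\<beta>. mord \<beta> < k}. mord \<beta> * chain_count k \<beta> * Dsup \<beta>
          + (\<Sum>i\<in>UNIV. chain_count k \<beta> * Dsup (up i \<beta>)))
        + (\<Sum>\<beta>\<in>{\<beta>. mord \<beta> = k}. mord \<beta> * chain_count k \<beta> * Dsup \<beta>)"
      unfolding Y'_def
    proof (intro norm_triangle_mono sum_norm_le)
      fix \<beta> assume \<beta>: "\<beta> \<in> {\<beta>. mord \<beta> < k}"
      then show "cmod (deriv (Q k \<beta>) s *\<^sub>R Dm \<beta> g (\<gamma> s)) \<le> mord \<beta> * chain_count k \<beta> * Dsup \<beta>"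
        unfolding norm_scaleR
        using Q_deriv_bound[of k \<beta> s] Dsup_upper[of \<beta> "\<gamma> s"] circ_S2 by (intro mult_mono) auto
      fix i
      have "\<bar>\<gamma>' i s * Q k \<beta> s\<bar> \<le> 1 * real (chain_count k \<beta>)"
        unfolding abs_mult[of "\<gamma>' i s"] using \<gamma>' Q_bound by (intro mult_mono) auto
      then show "cmod ((\<gamma>' i s * Q k \<beta> s) *\<^sub>R Dm (up i \<beta>) g (\<gamma> s)) \<le> chain_count k \<beta> * Dsup (up i \<beta>)"
        unfolding norm_scaleR
        using Dsup_upper[of "up i \<beta>" "\<gamma> s"] circ_S2 \<beta> by (intro mult_mono) auto
    next
      fix \<beta> assume "\<beta> \<in> {\<beta>. mord \<beta> = k}"
      then show "cmod (deriv (Q k \<beta>) s *\<^sub>R K \<beta>) \<le> mord \<beta> * chain_count k \<beta> * Dsup \<beta>"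
        unfolding norm_scaleR using Q_deriv_bound[of k \<beta> s] KD by (intro mult_mono) auto
    qed
    also have "\<dots> = (\<Sum>\<beta>\<in>{\<beta>. mord \<beta> < Suc k}. mord \<beta> * chain_count k \<beta> * Dsup \<beta>)
        + (\<Sum>i\<in>UNIV. \<Sum>\<beta>\<in>{\<beta>. mord \<beta> < k}. chain_count k \<beta> * Dsup (up i \<beta>))"
      by (simp add: sum_mord_less_Suc sum.distrib sum.swap[of _ UNIV])
    \<comment> \<open>Collecting the weights of each \<open>Dsup \<beta>\<close> reproduces the
      recursion for \<open>chain_count (Suc k) \<beta>\<close>.\<close>
    also have "\<dots> = (\<Sum>\<beta>\<in>{\<beta>. mord \<beta> < Suc k}. mord \<beta> * chain_count k \<beta> * Dsup \<beta>)
        + (\<Sum>i\<in>UNIV. \<Sum>\<beta>\<in>{\<beta>. mord \<beta> < Suc k}. if has_index i \<beta> then chain_count k (dn i \<beta>) * Dsup \<beta> else 0)"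
      by (intro arg_cong2[where f = "(+)"] sum.cong refl
          sum_up_reindex[where F = "\<lambda>\<beta>' \<beta>. chain_count k \<beta> * Dsup \<beta>'"]) (auto simp: mord_dn)
    also have "\<dots> = (\<Sum>\<beta>\<in>{\<beta>. mord \<beta> < Suc k}. chain_count (Suc k) \<beta> * Dsup \<beta>)"
      unfolding sum.swap[of _ _ UNIV] sum.distrib[symmetric]
      by (intro sum.cong refl) (auto simp: distrib_right sum_distrib_right intro!: sum.cong)
    also have "\<dots> \<le> fact (k + 3) / 2 * Dsum"
      using sum_chain_count_Dsup[of "Suc k"] by (simp only: add_Suc add_Suc_right numeral_3_eq_3 numeral_2_eq_2)
    finally show ?thesis .
  qed
  have fact_le: "fact (k + 2) \<le> (fact (k + 3) / 2 :: real)"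
  proof -
    have "2 * fact (k + 2) \<le> (real k + 3) * (fact (k + 2) :: real)"
      by (intro mult_right_mono) auto
    also have "\<dots> = fact (Suc (k + 2))" by (simp only: fact_Suc) simp
    finally show ?thesis by (simp add: numeral_3_eq_3 numeral_2_eq_2 del: fact_Suc)
  qed
  \<comment> \<open>For \<open>\<delta> \<le> 1\<close> the mean value bound suffices, as then
    \<open>\<delta> \<le> \<delta> powr \<alpha>\<close>; for larger \<open>\<delta>\<close> the
    triangle inequality does, as then \<open>\<delta> powr \<alpha> \<ge> 1\<close>.\<close>
  have Y_diff: "cmod (Y (t + \<delta>) - Y t) \<le> fact (k + 3) / 2 * \<delta> powr \<alpha> * Dsum"
  proof (cases "\<delta> \<le> 1")
    case True
    have "cmod (Y (t + \<delta>) - Y t) \<le> fact (k + 3) / 2 * Dsum * \<bar>t + \<delta> - t\<bar>"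
      by (rule norm_diff_le_vector_derivative[OF Y_deriv Y'_bound])
    also have "\<dots> = fact (k + 3) / 2 * Dsum * \<delta>" using \<delta> by simp
    also have "\<dots> \<le> fact (k + 3) / 2 * Dsum * \<delta> powr \<alpha>"
      using powr_mono'[of \<alpha> 1 \<delta>] True \<alpha> \<delta> Dsum_nonneg by (intro mult_left_mono) auto
    finally show ?thesis by (simp add: mult_ac)
  next
    case False
    have "cmod (Y (t + \<delta>) - Y t) \<le> fact (k + 2) / 2 * Dsum + fact (k + 2) / 2 * Dsum"
      by (rule order.trans[OF norm_triangle_ineq4 add_mono[OF Y_bound Y_bound]])
    also have "\<dots> = fact (k + 2) * Dsum" by simp
    also have "\<dots> \<le> fact (k + 3) / 2 * Dsum"
      using fact_le Dsum_nonneg by (rule mult_right_mono)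
    also have "\<dots> \<le> fact (k + 3) / 2 * Dsum * \<delta> powr \<alpha>"
      using mult_left_mono[of 1 "\<delta> powr \<alpha>" "fact (k + 3) / 2 * Dsum"]
        ge_one_powr_ge_zero[of \<delta> \<alpha>] False \<alpha> Dsum_nonneg by simp
    finally show ?thesis by (simp add: mult_ac)
  qed
  have top: "cmod (\<Sum>\<beta>\<in>{\<beta>. mord \<beta> = k}. Q k \<beta> t *\<^sub>R (K \<beta> - Dm \<beta> g (\<gamma> t))) \<le> fact (k + 3) * \<delta> powr \<alpha> * H"
  proof -
    have "(3 * \<delta>) powr \<alpha> \<le> 3 * \<delta> powr \<alpha>"
      using powr_mono[of \<alpha> 1 "3::real"] \<alpha> \<delta> by (simp add: powr_mult mult_right_mono)
    moreover have "norm (\<gamma> (t + \<delta>) - \<gamma> t) powr \<alpha> \<le> (3 * \<delta>) powr \<alpha>"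
      using circ_lipschitz[of "t + \<delta>" t] \<delta> \<alpha> by (intro powr_mono2) auto
    ultimately have "norm (\<gamma> (t + \<delta>) - \<gamma> t) powr \<alpha> \<le> 3 * \<delta> powr \<alpha>" by simp
    then have KH: "cmod (K \<beta> - Dm \<beta> g (\<gamma> t)) \<le> H * (3 * \<delta> powr \<alpha>)" if "mord \<beta> = k" for \<beta>
      unfolding K_def using H[OF that circ_S2 circ_S2] H0 mult_left_mono order.trans by blast
    have "cmod (\<Sum>\<beta>\<in>{\<beta>. mord \<beta> = k}. Q k \<beta> t *\<^sub>R (K \<beta> - Dm \<beta> g (\<gamma> t)))
        \<le> (\<Sum>\<beta>\<in>{\<beta>. mord \<beta> = k}. chain_count k \<beta> * (H * (3 * \<delta> powr \<alpha>)))"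
    proof (rule sum_norm_le)
      fix \<beta> assume "\<beta> \<in> {\<beta>. mord \<beta> = k}"
      then show "cmod (Q k \<beta> t *\<^sub>R (K \<beta> - Dm \<beta> g (\<gamma> t))) \<le> chain_count k \<beta> * (H * (3 * \<delta> powr \<alpha>))"
        unfolding norm_scaleR using Q_bound[of k \<beta>] KH by (intro mult_mono) auto
    qed
    also have "\<dots> = real (\<Sum>\<beta>\<in>{\<beta>. mord \<beta> = k}. chain_count k \<beta>) * (H * (3 * \<delta> powr \<alpha>))"
      by (simp add: sum_distrib_right)
    also have "\<dots> = 3 ^ Suc k * (H * \<delta> powr \<alpha>)"
      unfolding sum_chain_count_top by simp
    also have "\<dots> \<le> fact (k + 3) * (H * \<delta> powr \<alpha>)"
      using H0 by (intro mult_right_mono three_power_le_fact) auto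
    finally show ?thesis by (simp add: mult_ac)
  qed
  have "h k (t + \<delta>) - h k t = (Y (t + \<delta>) - Y t)
      + (\<Sum>\<beta>\<in>{\<beta>. mord \<beta> = k}. Q k \<beta> t *\<^sub>R (K \<beta> - Dm \<beta> g (\<gamma> t)))"
    unfolding h_def Y_def sum_mord_less_Suc by (simp add: K_def scaleR_diff_right sum_subtractf)
  then have "cmod (h k (t + \<delta>) - h k t) \<le> fact (k + 3) / 2 * \<delta> powr \<alpha> * Dsum + fact (k + 3) * \<delta> powr \<alpha> * H"
    using norm_triangle_mono[OF Y_diff top] by simp
  \<comment> \<open>The spare factor 1/2 on \<open>Dsum\<close> is given up so that
    \<open>Dsum\<close> and \<open>H\<close> carry the same constant and add up to the norm of the
    extension.\<close>
  also have "\<dots> \<le> fact (k + 3) * \<delta> powr \<alpha> * Dsum + fact (k + 3) * \<delta> powr \<alpha> * H"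
    using Dsum_nonneg by (intro add_right_mono mult_right_mono) auto
  finally show ?thesis by (simp add: distrib_left)
qed

end

section \<open>Fourier integrals\<close>

lemma integral_periodic_shift:
  fixes p :: "real \<Rightarrow> 'a::banach"
  assumes "continuous_on UNIV p" "\<And>t. p (t + T) = p t" "0 \<le> \<delta>" "\<delta> \<le> T"
  shows "integral {0..T} (\<lambda>t. p (t + \<delta>)) = integral {0..T} p"
proof -
  have int: "p integrable_on {a..b}" for a b
    by (rule integrable_continuous_real) (rule continuous_on_subset[OF assms(1)], simp)
  have "integral {0..T} (\<lambda>t. p (t + \<delta>)) = integral {\<delta>..T + \<delta>} p"
    using integral_shift_Icc_real[of 0 T p \<delta>] by (simp add: o_def add.commute)
  also have "\<dots> = integral {\<delta>..T} p + integral {T..T + \<delta>} p"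
    using assms(3,4) by (intro Henstock_Kurzweil_Integration.integral_combine[symmetric] int) auto
  also have "integral {T..T + \<delta>} p = integral {0..\<delta>} p"
    using integral_shift_Icc_real[of 0 \<delta> p T] assms(2) by (simp add: o_def add.commute)
  also have "integral {\<delta>..T} p + integral {0..\<delta>} p = integral {0..T} p"
    using Henstock_Kurzweil_Integration.integral_combine[OF assms(3,4) int] by (simp add: add.commute)
  finally show ?thesis .
qed

lemma norm_integral_le:
  fixes f :: "real \<Rightarrow> 'a::banach"
  assumes "a \<le> b" "0 \<le> B" "\<And>t. t \<in> {a..b} \<Longrightarrow> norm (f t) \<le> B"
  shows "norm (integral {a..b} f) \<le> B * (b - a)"
proof (cases "f integrable_on {a..b}")
  case True
  then show ?thesis
    using has_integral_bound_real[of B "{}" f _ a b] integrable_integral assms by fastforce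
next
  case False
  \<comment> \<open>The integral of a non-integrable function is 0 by convention.\<close>
  then show ?thesis using assms by (simp add: not_integrable_integral)
qed

lemma cis_two_pi_shift: "cis (- (of_int n * (t + 2 * pi))) = cis (- (of_int n * t))"
proof -
  have "cis (- (of_int n * (t + 2 * pi))) = cis (- (of_int n * t)) * cis (2 * pi * of_int (- n))"
    by (simp add: cis_mult algebra_simps)
  then show ?thesis by (simp only: cis_multiple_2pi Ints_of_int mult_1_right)
qed

text \<open>The derivative of \<open>u t * cis (- (of_int n * t))\<close> integrates to 0 over a
  full period, since the boundary values agree.\<close>

lemma fourier_integral_by_parts:
  assumes u: "\<And>t. (u has_vector_derivative u' t) (at t)" and cont: "continuous_on UNIV u'"
    and per: "\<And>t. u (t + 2 * pi) = u t"
  shows "integral {0..2 * pi} (\<lambda>t. u' t * cis (- (of_int n * t)))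
    = \<i> * of_int n * integral {0..2 * pi} (\<lambda>t. u t * cis (- (of_int n * t)))"
proof -
  let ?e = "\<lambda>t. cis (- (of_int n * t))"
  have e: "(?e has_vector_derivative - (\<i> * of_int n * ?e t)) (at t)" for t
    unfolding has_vector_derivative_def
    by (auto intro!: derivative_eq_intros simp: scaleR_conv_of_real algebra_simps)
  have ucont: "continuous_on UNIV u"
    using u by (auto intro!: continuous_at_imp_continuous_on has_vector_derivative_continuous)
  have c: "continuous_on A ?e" for A by (intro continuous_intros)
  have int: "(\<lambda>t. v t * ?e t) integrable_on {0..2 * pi}" if "continuous_on UNIV v" for v :: "real \<Rightarrow> complex"
    by (intro integrable_continuous_real continuous_intros c continuous_on_subset[OF that]) auto
  have "((\<lambda>t. u t * ?e t) has_vector_derivative u' t * ?e t - \<i> * of_int n * (u t * ?e t)) (at t)" for t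
    using has_vector_derivative_mult[OF u[of t] e[of t]] by (simp add: algebra_simps)
  then have "((\<lambda>t. u' t * ?e t - \<i> * of_int n * (u t * ?e t)) has_integral
      (u (2 * pi) * ?e (2 * pi) - u 0 * ?e 0)) {0..2 * pi}"
    by (intro fundamental_theorem_of_calculus) (auto intro: has_vector_derivative_at_within)
  then have "integral {0..2 * pi} (\<lambda>t. u' t * ?e t - \<i> * of_int n * (u t * ?e t)) = 0"
    using per[of 0] cis_two_pi_shift[of n 0] by (auto dest: integral_unique)
  moreover have "integral {0..2 * pi} (\<lambda>t. u' t * ?e t - \<i> * of_int n * (u t * ?e t))
     = integral {0..2 * pi} (\<lambda>t. u' t * ?e t) - \<i> * of_int n * integral {0..2 * pi} (\<lambda>t. u t * ?e t)"
    using int[OF cont] int[OF ucont] by (simp add: integral_diff integrable_on_mult_right)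
  ultimately show ?thesis by simp
qed

text \<open>Shifting by half a period of \<open>cis (- n t)\<close> flips its sign, so the coefficient is half of that of a difference.\<close>

lemma fourier_integral_le_modulus:
  fixes u :: "real \<Rightarrow> complex"
  assumes "continuous_on UNIV u" "\<And>t. u (t + 2 * pi) = u t" "n \<noteq> 0"
    and M: "\<And>t. cmod (u (t + pi / \<bar>of_int n\<bar>) - u t) \<le> M"
  shows "cmod (integral {0..2 * pi} (\<lambda>t. u t * cis (- (of_int n * t)))) \<le> pi * M"
proof -
  define \<delta> where "\<delta> = pi / \<bar>of_int n\<bar>"
  let ?e = "\<lambda>t. cis (- (of_int n * t))"
  let ?I = "integral {0..2 * pi} (\<lambda>t. u t * ?e t)"
  have n1: "1 \<le> \<bar>real_of_int n\<bar>" using assms(3) by linarith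
  have "pi / \<bar>real_of_int n\<bar> \<le> 2 * pi / 1"
    using n1 by (intro frac_le) auto
  then have \<delta>: "0 \<le> \<delta>" "\<delta> \<le> 2 * pi" by (auto simp: \<delta>_def)
  have M0: "0 \<le> M" using M[of 0] norm_ge_zero order.trans by blast
  have flip: "?e (t + \<delta>) = - ?e t" for t
  proof -
    have "real_of_int n * \<delta> = pi \<or> real_of_int n * \<delta> = - pi"
      using n1 by (auto simp: \<delta>_def abs_if)
    moreover have "?e (t + \<delta>) = ?e t * cis (- (of_int n * \<delta>))"
      by (simp add: cis_mult algebra_simps)
    ultimately show ?thesis by (auto simp: complex_eq_iff)
  qed
  have c: "continuous_on A ?e" for A by (intro continuous_intros)
  have uc: "continuous_on UNIV (\<lambda>t. u (t + s))" for s
    by (rule continuous_on_compose2[OF assms(1)]) (auto intro!: continuous_intros)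
  have int: "(\<lambda>t. v t * ?e t) integrable_on {0..2 * pi}" if "continuous_on UNIV v" for v :: "real \<Rightarrow> complex"
    by (intro integrable_continuous_real continuous_intros c continuous_on_subset[OF that]) auto
  have "?I = integral {0..2 * pi} (\<lambda>t. u (t + \<delta>) * ?e (t + \<delta>))"
    by (rule integral_periodic_shift[symmetric, where p = "\<lambda>t. u t * ?e t"])
       (use assms(2) \<delta> cis_two_pi_shift in \<open>auto intro!: continuous_intros assms(1)\<close>)
  also have "\<dots> = - integral {0..2 * pi} (\<lambda>t. u (t + \<delta>) * ?e t)"
    by (simp add: flip)
  \<comment> \<open>Averaging the integral with its shifted form leaves the increment of
    \<open>u\<close> by \<open>\<delta>\<close>; halving the bound \<open>2 * pi * M\<close> gives
    \<open>pi * M\<close>.\<close>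
  finally have "2 * ?I = ?I - integral {0..2 * pi} (\<lambda>t. u (t + \<delta>) * ?e t)" by simp
  also have "\<dots> = integral {0..2 * pi} (\<lambda>t. u t * ?e t - u (t + \<delta>) * ?e t)"
    by (rule integral_diff[symmetric]) (rule int[OF assms(1)], rule int[OF uc])
  finally have "2 * ?I = integral {0..2 * pi} (\<lambda>t. u t * ?e t - u (t + \<delta>) * ?e t)" .
  moreover have "cmod (integral {0..2 * pi} (\<lambda>t. u t * ?e t - u (t + \<delta>) * ?e t)) \<le> M * (2 * pi - 0)"
  proof (rule norm_integral_le)
    fix t
    have "cmod (u t * ?e t - u (t + \<delta>) * ?e t) = cmod (u (t + \<delta>) - u t)"
      by (simp add: norm_mult norm_minus_commute flip: left_diff_distrib)
    then show "cmod (u t * ?e t - u (t + \<delta>) * ?e t) \<le> M"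
      using M by (simp add: \<delta>_def)
  qed (use M0 in auto)
  ultimately have "cmod (2 * ?I) \<le> M * (2 * pi)" by simp
  then show ?thesis by (simp add: norm_mult mult_ac)
qed

context Ck_on_circle
begin

lemma h_fourier:
  "m \<le> k \<Longrightarrow> integral {0..2 * pi} (\<lambda>t. h m t * cis (- (of_int n * t)))
    = (\<i> * of_int n) ^ m * integral {0..2 * pi} (\<lambda>t. g (\<gamma> t) * cis (- (of_int n * t)))"
proof (induction m)
  case (Suc m)
  then show ?case
    using fourier_integral_by_parts[of "h m" "h (Suc m)" n] h_deriv continuous_h h_periodic by simp
qed (simp add: h_0)

lemma norm_h_fourier:
  assumes "n \<noteq> 0"
  shows "cmod (integral {0..2 * pi} (\<lambda>t. g (\<gamma> t) * cis (- (of_int n * t))))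
    = cmod (integral {0..2 * pi} (\<lambda>t. h k t * cis (- (of_int n * t)))) / \<bar>of_int n\<bar> ^ k"
  using assms by (simp add: h_fourier[of k n] norm_mult norm_power)

text \<open>Serves the case \<alpha> = 1, applied with \<open>k + 1\<close> for \<open>k\<close>:
  there the norm contains derivatives up to order \<open>k + 1\<close> and no Hoelder
  quotient.\<close>

lemma circle_fourier_Ck:
  assumes "n \<noteq> 0"
  shows "cmod (integral {0..2 * pi} (\<lambda>t. g (\<gamma> t) * cis (- (of_int n * t))))
    \<le> 2 * pi * (fact (k + 2) / 2 * Dsum / \<bar>of_int n\<bar> ^ k)"
proof -
  have "cmod (integral {0..2 * pi} (\<lambda>t. h k t * cis (- (of_int n * t)))) \<le> fact (k + 2) / 2 * Dsum * (2 * pi - 0)"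
    by (rule norm_integral_le)
       (use Dsum_nonneg order.trans[OF h_bound[OF order.refl] sum_chain_count_Dsup] in \<open>auto simp: norm_mult\<close>)
  from divide_right_mono[OF this, of "\<bar>of_int n\<bar> ^ k"] show ?thesis
    unfolding norm_h_fourier[OF assms] by (simp add: mult_ac)
qed

text \<open>The integrations by parts give \<open>\<bar>n\<bar> ^ k\<close>; the shift
  \<open>\<delta> = pi / \<bar>n\<bar>\<close> in \<open>h_holder\<close> gives the remaining power
  and \<open>pi powr \<alpha>\<close>.\<close>

lemma circle_fourier_holder:
  assumes "n \<noteq> 0" and \<alpha>: "0 < \<alpha>" "\<alpha> \<le> 1" and H0: "0 \<le> H"
    and H: "\<And>\<beta> x y. mord \<beta> = k \<Longrightarrow> x \<in> S2 \<Longrightarrow> y \<in> S2 \<Longrightarrow>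
      cmod (Dm \<beta> g x - Dm \<beta> g y) \<le> H * norm (x - y) powr \<alpha>"
  shows "cmod (integral {0..2 * pi} (\<lambda>t. g (\<gamma> t) * cis (- (of_int n * t))))
    \<le> 2 * pi * (fact (k + 3) * pi powr \<alpha> / 2 * (Dsum + H) / \<bar>of_int n\<bar> powr (real k + \<alpha>))"
proof -
  have "cmod (integral {0..2 * pi} (\<lambda>t. h k t * cis (- (of_int n * t))))
      \<le> pi * (fact (k + 3) * (pi / \<bar>of_int n\<bar>) powr \<alpha> * (Dsum + H))"
  proof (rule fourier_integral_le_modulus)
    show "cmod (h k (t + pi / \<bar>of_int n\<bar>) - h k t) \<le> fact (k + 3) * (pi / \<bar>of_int n\<bar>) powr \<alpha> * (Dsum + H)" for t
      by (rule h_holder[OF \<alpha> _ H0 H]) (use assms(1) in auto)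
  qed (use assms(1) h_periodic continuous_h in auto)
  then have "cmod (integral {0..2 * pi} (\<lambda>t. g (\<gamma> t) * cis (- (of_int n * t))))
      \<le> pi * (fact (k + 3) * (pi / \<bar>of_int n\<bar>) powr \<alpha> * (Dsum + H)) / \<bar>of_int n\<bar> ^ k"
    using assms(1) by (simp add: norm_h_fourier divide_right_mono)
  also have "\<dots> = 2 * pi * (fact (k + 3) * pi powr \<alpha> / 2 * (Dsum + H) / \<bar>of_int n\<bar> powr (real k + \<alpha>))"
    using assms(1) by (simp add: powr_add powr_divide powr_realpow field_simps)
  finally show ?thesis .
qed

end

section \<open>The DFS function on latitudes and meridians\<close>

lemma sph_param_S2: "sph_param l \<theta> \<in> S2"
proof -
  have "(cos l * sin \<theta>)\<^sup>2 + (sin l * sin \<theta>)\<^sup>2 + (cos \<theta>)\<^sup>2 = 1"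
    by (simp add: power_mult_distrib cos_squared_eq algebra_simps)
  then show ?thesis
    by (simp add: sph_param_def norm_vec_def L2_set_def sum_3)
qed

text \<open>Sines are written as cosines with phase \<open>- (pi / 2)\<close>; the constant height
  is the third coordinate of the centre, with radius 0 there.\<close>

lemma sph_param_latitude:
  "circ (vector [0, 0, cos \<theta>]) (vector [sin \<theta>, sin \<theta>, 0]) (vector [0, - (pi / 2), 0]) t = sph_param t \<theta>"
  by (simp add: circ_def sph_param_def vec_eq_iff forall_3 cos_add)

lemma sph_param_meridian:
  "circ 0 (vector [cos l, sin l, 1]) (vector [- (pi / 2), - (pi / 2), 0]) t = sph_param l t"
  by (simp add: circ_def sph_param_def vec_eq_iff forall_3 cos_add)

lemma Ck_on_circle_latitude:
  assumes "open U" "S2 \<subseteq> U" "Ck U k g"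
  shows "Ck_on_circle U k g (vector [0, 0, cos \<theta>]) (vector [sin \<theta>, sin \<theta>, 0]) (vector [0, - (pi / 2), 0])"
proof
  show "\<bar>vector [sin \<theta>, sin \<theta>, 0] $ i\<bar> \<le> (1::real)" for i :: 3
    using exhaust_3[of i] by auto
qed (simp_all only: sph_param_latitude assms sph_param_S2)

lemma Ck_on_circle_meridian:
  assumes "open U" "S2 \<subseteq> U" "Ck U k g"
  shows "Ck_on_circle U k g 0 (vector [cos l, sin l, 1]) (vector [- (pi / 2), - (pi / 2), 0])"
proof
  show "\<bar>vector [cos l, sin l, 1] $ i\<bar> \<le> (1::real)" for i :: 3
    using exhaust_3[of i] by auto
qed (simp_all only: sph_param_meridian assms sph_param_S2)

lemma continuous_sph_param: "continuous_on A (\<lambda>z. sph_param (fst z) (snd z))"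
proof -
  have eq: "(\<lambda>z. sph_param (fst z) (snd z)) = (\<lambda>z. \<chi> i. if i = 1 then cos (fst z) * sin (snd z)
      else if i = 2 then sin (fst z) * sin (snd z) else cos (snd z))"
    by (auto simp: sph_param_def vec_eq_iff forall_3 fun_eq_iff)
  have c: "continuous_on A (\<lambda>z. if i = 1 then cos (fst z) * sin (snd z)
      else if i = 2 then sin (fst z) * sin (snd z) else cos (snd z))" for i :: 3
    using exhaust_3[of i] by (auto intro!: continuous_intros)
  show ?thesis unfolding eq by (intro continuous_on_vec_lambda c)
qed

text \<open>By Fubini the exponential in the outer variable leaves the inner integral with modulus
  1, so a uniform inner bound in either variable suffices; two factors \<open>2 * pi\<close> cancel
  the normalization.\<close>

lemma fourier_coeff_le_iterated:
  fixes G :: "real \<times> real \<Rightarrow> complex"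
  assumes cont: "continuous_on UNIV G" and M: "0 \<le> M"
    and "(\<forall>y. cmod (integral {0..2 * pi} (\<lambda>x. G (x, y) * cis (- (of_int (fst n) * x)))) \<le> 2 * pi * M)
       \<or> (\<forall>x. cmod (integral {0..2 * pi} (\<lambda>y. G (x, y) * cis (- (of_int (snd n) * y)))) \<le> 2 * pi * M)"
  shows "cmod (fourier_coeff G n) \<le> M"
proof -
  define F where "F x y = G (x, y) * cis (- (of_int (fst n) * x + of_int (snd n) * y))" for x y
  let ?I = "integral (cbox (0, 0) (2 * pi, 2 * pi)) (\<lambda>(x, y). F x y)"
  have F: "continuous_on (cbox (0, 0) (2 * pi, 2 * pi)) (\<lambda>(x, y). F x y)"
    unfolding F_def split_beta by (intro continuous_intros continuous_on_compose2[OF cont]) auto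
  have x: "?I = integral {0..2 * pi} (\<lambda>x. integral {0..2 * pi} (\<lambda>y. F x y))"
    using integral_prod_continuous[OF F] by simp
  have y: "?I = integral {0..2 * pi} (\<lambda>y. integral {0..2 * pi} (\<lambda>x. F x y))"
    using x integral_swap_continuous[OF F] by simp
  have "cmod ?I \<le> 2 * pi * M * (2 * pi - 0)"
    using assms(3)
  proof
    assume *: "\<forall>y. cmod (integral {0..2 * pi} (\<lambda>x. G (x, y) * cis (- (of_int (fst n) * x)))) \<le> 2 * pi * M"
    have "integral {0..2 * pi} (\<lambda>x. F x y)
        = integral {0..2 * pi} (\<lambda>x. G (x, y) * cis (- (of_int (fst n) * x))) * cis (- (of_int (snd n) * y))" for y
      unfolding integral_mult_left[symmetric]
      by (intro integral_cong) (simp add: F_def cis_mult mult.assoc)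
    then show ?thesis
      unfolding y by (intro norm_integral_le) (use * M in \<open>auto simp: norm_mult\<close>)
  next
    assume *: "\<forall>x. cmod (integral {0..2 * pi} (\<lambda>y. G (x, y) * cis (- (of_int (snd n) * y)))) \<le> 2 * pi * M"
    have "integral {0..2 * pi} (\<lambda>y. F x y)
        = integral {0..2 * pi} (\<lambda>y. G (x, y) * cis (- (of_int (snd n) * y))) * cis (- (of_int (fst n) * x))" for x
      unfolding integral_mult_left[symmetric]
      by (intro integral_cong) (simp add: F_def cis_mult mult.assoc add.commute)
    then show ?thesis
      unfolding x by (intro norm_integral_le) (use * M in \<open>auto simp: norm_mult\<close>)
  qed
  then have "cmod ?I / (2 * pi)\<^sup>2 \<le> M"
    by (simp add: field_simps power2_eq_square)
  moreover have "cmod (fourier_coeff G n) = cmod ?I / (2 * pi)\<^sup>2"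
    unfolding fourier_coeff_def F_def by (simp add: norm_mult norm_divide norm_power)
  ultimately show ?thesis by simp
qed

text \<open>From \<open>int_norm n \<le> sqrt 2 * r\<close>; this is the origin of the power of 2 in
  the theorem.\<close>

lemma int_norm_powr_le:
  assumes "n = (p, q)" "0 \<le> s" "r = max \<bar>p\<bar> \<bar>q\<bar>"
  shows "int_norm n powr s \<le> 2 powr (s / 2) * real_of_int r powr s"
proof -
  have "(real_of_int p)\<^sup>2 \<le> (real_of_int r)\<^sup>2" "(real_of_int q)\<^sup>2 \<le> (real_of_int r)\<^sup>2"
    unfolding abs_le_square_iff[symmetric] using assms by auto
  then have "int_norm n \<le> sqrt (2 * (real_of_int r)\<^sup>2)"
    unfolding int_norm_def assms by (intro real_sqrt_le_mono) simp
  also have "\<dots> = sqrt 2 * real_of_int r"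
    using assms by (simp add: real_sqrt_mult)
  finally have "int_norm n powr s \<le> (sqrt 2 * real_of_int r) powr s"
    using assms by (intro powr_mono2) (auto simp: int_norm_def)
  also have "\<dots> = 2 powr (s / 2) * real_of_int r powr s"
    using assms by (simp add: powr_mult powr_powr flip: powr_half_sqrt)
  finally show ?thesis .
qed

text \<open>The common frame of the two cases: \<open>E\<close> and \<open>s\<close> are the
  constant and the decay exponent of the one-dimensional estimate, which is applied to latitudes if
  the first frequency dominates and to meridians otherwise.\<close>

lemma fourier_coeff_dfs_le:
  assumes U: "open U" "S2 \<subseteq> U" and Ck: "Ck U k g" and "n \<noteq> (0, 0)" "0 \<le> E" "0 \<le> s"
    and circle: "\<And>\<kappa> \<rho> \<phi> p. Ck_on_circle U k g \<kappa> \<rho> \<phi> \<Longrightarrow> p \<noteq> 0 \<Longrightarrow>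
      cmod (integral {0..2 * pi} (\<lambda>t. g (circ \<kappa> \<rho> \<phi> t) * cis (- (of_int p * t))))
        \<le> 2 * pi * (E / \<bar>of_int p\<bar> powr s)"
  shows "cmod (fourier_coeff (dfs g) n) \<le> 2 powr (s / 2) * E / int_norm n powr s"
proof -
  obtain p q where n: "n = (p, q)" by (cases n)
  define r where "r = max \<bar>p\<bar> \<bar>q\<bar>"
  have r: "r > 0" using assms(4) by (auto simp: n r_def)
  have "continuous_on U (Dm (0, 0, 0) g)"
    by (rule Dm_continuous_on[OF U(1) Ck]) (simp add: mord_def)
  then have gU: "continuous_on U g" by (simp add: Dm_def canon_def)
  have "continuous_on UNIV (\<lambda>z. g (sph_param (fst z) (snd z)))"
    by (rule continuous_on_compose2[OF gU continuous_sph_param]) (use U sph_param_S2 in blast)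
  then have cont: "continuous_on UNIV (dfs g)"
    by (simp add: dfs_def split_beta)
  have "cmod (fourier_coeff (dfs g) n) \<le> E / real_of_int r powr s"
  proof (rule fourier_coeff_le_iterated[OF cont])
    show "0 \<le> E / real_of_int r powr s" using assms by simp
    show "(\<forall>y. cmod (integral {0..2 * pi} (\<lambda>x. dfs g (x, y) * cis (- (of_int (fst n) * x)))) \<le> 2 * pi * (E / real_of_int r powr s))
       \<or> (\<forall>x. cmod (integral {0..2 * pi} (\<lambda>y. dfs g (x, y) * cis (- (of_int (snd n) * y)))) \<le> 2 * pi * (E / real_of_int r powr s))"
    proof (cases "\<bar>q\<bar> \<le> \<bar>p\<bar>")
      case True
      then have "p \<noteq> 0" "\<bar>real_of_int p\<bar> = real_of_int r" using r by (auto simp: r_def)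
      then show ?thesis
        using circle[OF Ck_on_circle_latitude[OF U Ck], of p]
        by (simp add: sph_param_latitude dfs_def n)
    next
      case False
      then have "q \<noteq> 0" "\<bar>real_of_int q\<bar> = real_of_int r" using r by (auto simp: r_def)
      then show ?thesis
        using circle[OF Ck_on_circle_meridian[OF U Ck], of q]
        by (simp add: sph_param_meridian dfs_def n)
    qed
  qed
  also have "\<dots> \<le> 2 powr (s / 2) * E / int_norm n powr s"
  proof -
    have "int_norm n > 0"
      using assms(4) unfolding int_norm_def n by (auto simp: sum_power2_gt_zero_iff)
    moreover have "E * int_norm n powr s \<le> E * (2 powr (s / 2) * real_of_int r powr s)"
      using assms by (intro mult_left_mono int_norm_powr_le[OF n _ r_def]) auto
    ultimately show ?thesis using r by (simp add: field_simps)
  qed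
  finally show ?thesis .
qed

section \<open>From extensions to the norm on the sphere\<close>

lemma holder_quots_S2_Sup:
  assumes "bdd_above (holder_quots S2 k \<alpha> g)"
  shows "mord \<beta> = k \<Longrightarrow> x \<in> S2 \<Longrightarrow> y \<in> S2 \<Longrightarrow>
      cmod (Dm \<beta> g x - Dm \<beta> g y) \<le> Sup (holder_quots S2 k \<alpha> g) * norm (x - y) powr \<alpha>"
    and "0 \<le> Sup (holder_quots S2 k \<alpha> g)"
proof -
  have upper: "cmod (Dm \<beta> g x - Dm \<beta> g y) / norm (x - y) powr \<alpha> \<le> Sup (holder_quots S2 k \<alpha> g)"
    if "mord \<beta> = k" "x \<in> S2" "y \<in> S2" "x \<noteq> y" for \<beta> x y
    by (rule cSup_upper[OF _ assms]) (use that in \<open>unfold holder_quots_def, blast\<close>)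
  show "cmod (Dm \<beta> g x - Dm \<beta> g y) \<le> Sup (holder_quots S2 k \<alpha> g) * norm (x - y) powr \<alpha>"
    if "mord \<beta> = k" "x \<in> S2" "y \<in> S2"
    using upper[OF that] by (cases "x = y") (auto simp: field_simps)
  \<comment> \<open>Two antipodal points show that the set of quotients is nonempty, so its supremum
    dominates a nonnegative number.\<close>
  have "mord (k, 0, 0) = k" by (simp add: mord_def)
  moreover have "axis 1 1 \<in> S2" "- axis 1 1 \<in> S2" by (auto simp: norm_axis_1)
  moreover have "axis 1 1 \<noteq> (- axis 1 1 :: real^3)"
    by (auto simp: vec_eq_iff axis_def)
  ultimately show "0 \<le> Sup (holder_quots S2 k \<alpha> g)"
    using order.trans[OF _ upper] by (meson divide_nonneg_nonneg norm_ge_zero powr_ge_zero)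
qed

lemma dfs_fourier_holder_extension:
  assumes U: "open U" "S2 \<subseteq> U" "Cka U k \<alpha> g" and \<alpha>: "0 < \<alpha>" "\<alpha> \<le> 1" and "n \<noteq> (0, 0)"
  shows "cmod (fourier_coeff (dfs g) n)
    \<le> 2 powr ((real k + \<alpha>) / 2 - 1) * pi powr \<alpha> * fact (k + 3) / int_norm n powr (real k + \<alpha>) * ext_norm k \<alpha> g"
proof -
  have Ck: "Ck U k g" using U by (simp add: Cka_def)
  have "holder_quots S2 k \<alpha> g \<subseteq> holder_quots U k \<alpha> g"
    unfolding holder_quots_def using U(2) by blast
  then have "bdd_above (holder_quots S2 k \<alpha> g)"
    using U \<alpha> by (auto simp: Cka_def intro: bdd_above_mono)
  note H = holder_quots_S2_Sup[OF this]
  \<comment> \<open>\<open>Dsum\<close> depends on \<open>k\<close> and \<open>g\<close> alone, so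
    the norm of the extension decomposes in the same way for every circle.\<close>
  have N: "ext_norm k \<alpha> g = Ck_on_circle.Dsum k g + Sup (holder_quots S2 k \<alpha> g)"
    if "Ck_on_circle U k g \<kappa> \<rho> \<phi>" for \<kappa> \<rho> \<phi>
    using \<alpha> by (simp add: ext_norm_def Bk_eq Ck_on_circle.Dsum_def[OF that] Ck_on_circle.Dsup_def[OF that])
  have N0: "0 \<le> ext_norm k \<alpha> g"
    using N[OF Ck_on_circle_meridian[OF U(1,2) Ck]] H(2)
      Ck_on_circle.Dsum_nonneg[OF Ck_on_circle_meridian[OF U(1,2) Ck]] by simp
  have "cmod (fourier_coeff (dfs g) n) \<le> 2 powr ((real k + \<alpha>) / 2)
      * (fact (k + 3) * pi powr \<alpha> / 2 * ext_norm k \<alpha> g) / int_norm n powr (real k + \<alpha>)"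
  proof (rule fourier_coeff_dfs_le[OF U(1,2) Ck assms(6)])
    fix \<kappa> \<rho> \<phi> and p :: int assume c: "Ck_on_circle U k g \<kappa> \<rho> \<phi>" "p \<noteq> 0"
    show "cmod (integral {0..2 * pi} (\<lambda>t. g (circ \<kappa> \<rho> \<phi> t) * cis (- (of_int p * t))))
        \<le> 2 * pi * (fact (k + 3) * pi powr \<alpha> / 2 * ext_norm k \<alpha> g / \<bar>of_int p\<bar> powr (real k + \<alpha>))"
      unfolding N[OF c(1)] by (rule Ck_on_circle.circle_fourier_holder[OF c \<alpha> H(2,1)])
  qed (use N0 \<alpha> in auto)
  then show ?thesis by (simp add: powr_diff mult_ac)
qed

lemma dfs_fourier_Ck_extension:
  assumes U: "open U" "S2 \<subseteq> U" "Cka U (k + 1) 0 g" and "n \<noteq> (0, 0)"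
  shows "cmod (fourier_coeff (dfs g) n)
    \<le> 2 powr ((real k + 1) / 2 - 1) * pi powr 1 * fact (k + 3) / int_norm n powr (real k + 1) * ext_norm (k + 1) 0 g"
proof -
  have Ck: "Ck U (k + 1) g" using U by (simp add: Cka_def)
  have N: "ext_norm (k + 1) 0 g = Ck_on_circle.Dsum (k + 1) g"
    if "Ck_on_circle U (k + 1) g \<kappa> \<rho> \<phi>" for \<kappa> \<rho> \<phi>
    unfolding ext_norm_def Bk_eq Ck_on_circle.Dsum_def[OF that] Ck_on_circle.Dsup_def[OF that] by simp
  have N0: "0 \<le> ext_norm (k + 1) 0 g"
    using N[OF Ck_on_circle_meridian[OF U(1,2) Ck]]
      Ck_on_circle.Dsum_nonneg[OF Ck_on_circle_meridian[OF U(1,2) Ck]] by simp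
  have "cmod (fourier_coeff (dfs g) n) \<le> 2 powr (real (k + 1) / 2)
      * (fact (k + 1 + 2) / 2 * ext_norm (k + 1) 0 g) / int_norm n powr real (k + 1)"
  proof (rule fourier_coeff_dfs_le[OF U(1,2) Ck assms(4)])
    fix \<kappa> \<rho> \<phi> and p :: int assume c: "Ck_on_circle U (k + 1) g \<kappa> \<rho> \<phi>" "p \<noteq> 0"
    have "\<bar>real_of_int p\<bar> powr real (k + 1) = \<bar>real_of_int p\<bar> ^ (k + 1)"
      using c(2) by (intro powr_realpow) simp
    then show "cmod (integral {0..2 * pi} (\<lambda>t. g (circ \<kappa> \<rho> \<phi> t) * cis (- (of_int p * t))))
        \<le> 2 * pi * (fact (k + 1 + 2) / 2 * ext_norm (k + 1) 0 g / \<bar>of_int p\<bar> powr real (k + 1))"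
      using Ck_on_circle.circle_fourier_Ck[OF c] unfolding N[OF c(1)] by simp
  qed (use N0 in auto)
  also have "\<dots> = 2 powr ((real k + 1) / 2 - 1) * 1 * fact (k + 3) / int_norm n powr (real k + 1) * ext_norm (k + 1) 0 g"
  proof -
    have "k + 1 + 2 = k + 3" "real (k + 1) = real k + 1" by auto
    then show ?thesis by (simp only: powr_diff) simp
  qed
  \<comment> \<open>This case is better by a factor \<open>pi\<close>, which is given away to reach
    the common form.\<close>
  also have "\<dots> \<le> 2 powr ((real k + 1) / 2 - 1) * pi powr 1 * fact (k + 3) / int_norm n powr (real k + 1) * ext_norm (k + 1) 0 g"
    using pi_gt3 N0 by (intro mult_right_mono divide_right_mono mult_left_mono) auto
  finally show ?thesis .
qed

text \<open>Lets an extension replace \<open>f\<close> in the Fourier coefficient.\<close>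

lemma dfs_cong_S2: "(\<And>x. x \<in> S2 \<Longrightarrow> g x = f x) \<Longrightarrow> dfs g = dfs f"
  using sph_param_S2 by (auto simp: dfs_def fun_eq_iff)

lemma le_mult_sph_norm0:
  assumes "sph_space0 k \<alpha> f" "0 < C"
    and "\<And>g U. open U \<Longrightarrow> S2 \<subseteq> U \<Longrightarrow> Cka U k \<alpha> g \<Longrightarrow> cmod (fourier_coeff (dfs g) n) \<le> C * ext_norm k \<alpha> g"
  shows "cmod (fourier_coeff (dfs f) n) \<le> C * sph_norm0 k \<alpha> f"
proof -
  have "cmod (fourier_coeff (dfs f) n) / C \<le> sph_norm0 k \<alpha> f"
    unfolding sph_norm0_def
  proof (rule cINF_greatest)
    \<comment> \<open>A lower bound for all extensions passes to the infimum only over a nonempty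
      set, which membership in the space guarantees.\<close>
    show "extensions k \<alpha> f \<noteq> {}" using assms(1) by (simp add: sph_space0_def)
    fix g assume "g \<in> extensions k \<alpha> f"
    then obtain U where "open U" "S2 \<subseteq> U" "Cka U k \<alpha> g" "\<forall>x\<in>S2. g x = f x"
      unfolding extensions_def by blast
    then show "cmod (fourier_coeff (dfs f) n) / C \<le> ext_norm k \<alpha> g"
      using assms(3)[of U g] dfs_cong_S2[of g f] assms(2) by (simp add: field_simps)
  qed
  then show ?thesis using assms(2) by (simp add: field_simps)
qed

theorem theorem5p7:
  fixes k :: nat and \<alpha> :: real and f :: "real^3 \<Rightarrow> complex" and n :: "int \<times> int"
  assumes "0 < \<alpha>" and "\<alpha> \<le> 1"
    and "C_sphere k \<alpha> f"
    and "n \<noteq> (0, 0)"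
  shows "cmod (fourier_coeff (dfs f) n)
           \<le> 2 powr ((real k + \<alpha>) / 2 - 1) * pi powr \<alpha> * fact (k + 3)
               / int_norm n powr (real k + \<alpha>) * C_sphere_norm k \<alpha> f"
proof -
  have "int_norm n > 0"
    using assms(4) unfolding int_norm_def by (cases n) (auto simp: sum_power2_gt_zero_iff)
  then have C: "0 < 2 powr ((real k + \<alpha>) / 2 - 1) * pi powr \<alpha> * fact (k + 3) / int_norm n powr (real k + \<alpha>)"
    by simp
  show ?thesis
  \<comment> \<open>For \<alpha> = 1 the norm is by convention that of order \<open>k + 1\<close>,
    so the bound without Hoelder quotients applies.\<close>
  proof (cases "\<alpha> = 1")
    case True
    with assms(3) have "sph_space0 (k + 1) 0 f" by (simp add: C_sphere_def)
    from le_mult_sph_norm0[OF this C] show ?thesis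
      using dfs_fourier_Ck_extension[OF _ _ _ assms(4)] True by (simp add: C_sphere_norm_def)
  next
    case False
    with assms(3) have "sph_space0 k \<alpha> f" by (simp add: C_sphere_def)
    from le_mult_sph_norm0[OF this C dfs_fourier_holder_extension[OF _ _ _ assms(1,2,4)]] False show ?thesis
      by (simp add: C_sphere_norm_def)
  qed
qed

end
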